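(* Let $\beta\in[-1,1]$, $p\in(1,\infty)$, $(u_0,u_1)\in H^1(\mathbb R^n)\times L^2(\mathbb R^n)$, and let $\ell\in\mathbb N$ with $\ell>2p'$, where $p'=p/(p-1)$. Let $u$ be the associated strong solution of $$u_{tt}-\Delta u+b(t)u_t=|u|^p,\qquad u(0)=u_0,\quad u_t(0)=u_1$$ on $[0,T_0)$, where $T_0$ is its lifespan. For $\phi\in\mathcal S(\mathbb R^n;[0,\infty))$ put $$I_\phi(t)=\int_{\mathbb R^n}u(t,x)\phi^\ell(x)\,dx .$$ Assume that there exists $\phi\in\mathcal S(\mathbb R^n;[0,\infty))$ such that $$0<I_\phi(0)-A(n,p,\ell,\phi)<2^{\frac1{p-1}}\|\phi^\ell\|_{L^1(\mathbb R^n)},\qquad I_\phi'(0)>0 .$$ Let $$J_\phi(t)=I_\phi(t)-A(n,p,\ell,\phi),\qquad \widetilde J_\phi(0)=2^{-\frac1{p-1}}\|\phi^\ell\|_{L^1(\mathbb R^n)}^{-1}J_\phi(0),$$ $$A_1=\frac{J_\phi'(0)}{J_\phi(0)}=\frac{I_\phi'(0)}{I_\phi(0)-A(n,p,\ell,\phi)} .$$ Then $$J_\phi(t)\ge J_\phi(0)\Bigl(1-\mu(p,b,\beta,A_1)\,\widetilde J_\phi(0)^{p-1}B(t)\Bigr)^{-\frac2{p-1}}\qquad\text{for } t\in[0,T_0).$$ Moreover, the lifespan satisfies $$T_0\le B^{-1}\Bigl(\mu(p,b,\beta,A_1)^{-1}\,\widetilde J_\phi(0)^{1-p}\Bigr)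.$$
   Context: Standing assumption: $b:[0,\infty)\to(0,\infty)$ is smooth and there are constants $b_1,b_2,b_3>0$ such that, for all $t\ge0$, $$b_1(1+t)^{-\beta}\le b(t)\le b_2(1+t)^{-\beta},\qquad |b'(t)|\le b_3(1+t)^{-1}b(t),$$ with $\beta\in[-1,1]$. Functions are real-valued and $n\ge1$ is the space dimension. Set $B(t)=\int_0^t b(\tau)^{-1}d\tau$; this is a strictly increasing bijection of $[0,\infty)$ with inverse $B^{-1}$. For $\beta\in(-1,1]$, $B_4>0$ denotes a fixed constant such that $B^{-1}(\tau)\le B_4(1+\tau)^{1/(1+\beta)}$ for all $\tau\ge0$ (such a constant exists). For $A>0$, $$\mu(p,b,\beta,A)=\min\Bigl\{1,\ \tfrac{p-1}{2}b(0)A,\ \Bigl[\tfrac{2(p+1)}{(p-1)^2}b_1^{-2}\bigl\{2^{\frac1{1+\beta}}(1+B_4)\bigr\}^{\max(0,2\beta)}+\tfrac{2(b_1^{-1}b_3+1)}{p-1}\Bigr]^{-1}\Bigr\},$$ where the factor $\{\cdots\}^{\max(0,2\beta)}$ is interpreted as $1$ if $\beta=-1$. For $\phi\ge0$ and $\ell\in\mathbb N$, $\ell>2p'$, $$A(n,p,\ell,\phi)=2^{p'-1}p'^{-\frac1p}p^{\frac{1-p'}{p}}\bigl\||\Phi|^{p'}\phi^{\ell-2p'}\bigr\|_{L^1(\mathbb R^n)}^{\frac1p}\|\phi^\ell\|_{L^1(\mathbb R^n)}^{\frac1{p'}},\qquad \Phi=\ell(\ell-1)\nabla\phi\cdot\nabla\phi+\ell\phi\Delta\phi$$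 (so that $\Delta(\phi^\ell)=\phi^{\ell-2}\Phi$). $\mathcal S(\mathbb R^n;[0,\infty))$ is the set of Schwartz functions with values in $[0,\infty)$. Strong solution on $[0,T)$, $T\in(0,\infty]$: a function $u\in C^2([0,T);H^{-1}(\mathbb R^n))\cap C^1([0,T);L^2(\mathbb R^n))\cap C([0,T);H^1(\mathbb R^n))$ satisfying $u(0)=u_0$, $u_t(0)=u_1$ and the equation $u_{tt}-\Delta u+b(t)u_t=|u|^p$ in $C([0,T);H^{-1}(\mathbb R^n))$. The lifespan is $T_0=\sup\{T>0: u \text{ is a strong solution on }[0,T)\}$. *)

theory Defs
  imports "HOL-Analysis.Analysis"
begin

section \<open>Classical derivatives and Schwartz functions on \<open>\<real>\<^sup>n\<close>\<close>

definition partial_deriv :: "'n::finite \<Rightarrow> (real^'n \<Rightarrow> real) \<Rightarrow> real^'n \<Rightarrow> real" where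
  "partial_deriv i f x = frechet_derivative f (at x) (axis i 1)"

definition gradient :: "(real^'n::finite \<Rightarrow> real) \<Rightarrow> real^'n \<Rightarrow> real^'n" where
  "gradient f x = (\<chi> i. partial_deriv i f x)"

definition laplacian :: "(real^'n::finite \<Rightarrow> real) \<Rightarrow> real^'n \<Rightarrow> real" where
  "laplacian f x = (\<Sum>i\<in>UNIV. partial_deriv i (partial_deriv i f) x)"

(* The list of indices plays the role of a multi-index. *)
primrec iter_partial :: "'n::finite list \<Rightarrow> (real^'n \<Rightarrow> real) \<Rightarrow> real^'n \<Rightarrow> real" where
  "iter_partial [] f = f"
| "iter_partial (i # is) f = partial_deriv i (iter_partial is f)"

definition schwartz :: "(real^'n::finite \<Rightarrow> real) \<Rightarrow> bool" where
  "schwartz f \<longleftrightarrow>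
     (\<forall>is x. iter_partial is f differentiable (at x)) \<and>
     (\<forall>is k. bounded (range (\<lambda>x. norm x ^ k * iter_partial is f x)))"


section \<open>The space \<open>L\<^sup>2(\<real>\<^sup>n)\<close>\<close>

definition square_integrable :: "(real^'n::finite \<Rightarrow> real) \<Rightarrow> bool" where
  "square_integrable f \<longleftrightarrow>
     f \<in> borel_measurable lborel \<and> integrable lborel (\<lambda>x. (f x)\<^sup>2)"

definition L2_eq :: "(real^'n::finite \<Rightarrow> real) \<Rightarrow> (real^'n \<Rightarrow> real) \<Rightarrow> bool" where
  "L2_eq f g \<longleftrightarrow>
     square_integrable f \<and> square_integrable g \<and> (AE x in lborel. f x = g x)"

lemma square_integrable_zero: "square_integrable (\<lambda>x. 0)"
  by (simp add: square_integrable_def)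

lemma square_integrable_mult:
  assumes "square_integrable f" "square_integrable g"
  shows "integrable lborel (\<lambda>x. f x * g x)"
proof (rule Bochner_Integration.integrable_bound)
  show "integrable lborel (\<lambda>x. (f x)\<^sup>2 + (g x)\<^sup>2)"
    using assms by (simp add: square_integrable_def)
  show "(\<lambda>x. f x * g x) \<in> borel_measurable lborel"
    using assms by (auto simp: square_integrable_def intro!: borel_measurable_times)
  have "\<bar>a * b\<bar> \<le> a\<^sup>2 + b\<^sup>2" for a b :: real
  proof -
    have "2 * (\<bar>a\<bar> * \<bar>b\<bar>) \<le> a\<^sup>2 + b\<^sup>2"
      using sum_squares_bound[of "\<bar>a\<bar>" "\<bar>b\<bar>"] by (simp add: mult.assoc)
    moreover have "0 \<le> \<bar>a\<bar> * \<bar>b\<bar>" by simp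
    ultimately show ?thesis unfolding abs_mult by linarith
  qed
  then show "AE x in lborel. norm (f x * g x) \<le> norm ((f x)\<^sup>2 + (g x)\<^sup>2)"
    by simp
qed

lemma square_integrable_add:
  assumes "square_integrable f" "square_integrable g"
  shows "square_integrable (\<lambda>x. f x + g x)"
proof -
  have "integrable lborel (\<lambda>x. (f x)\<^sup>2 + (g x)\<^sup>2 + 2 * (f x * g x))"
    using assms square_integrable_mult[OF assms] by (simp add: square_integrable_def)
  then show ?thesis
    using assms by (auto simp: square_integrable_def power2_sum mult.assoc
        intro!: borel_measurable_add)
qed

lemma square_integrable_scale:
  assumes "square_integrable f"
  shows "square_integrable (\<lambda>x. c * f x)"
  using assms by (auto simp: square_integrable_def power_mult_distrib
      intro!: borel_measurable_times)

lemma square_integrable_diff: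
  assumes "square_integrable f" "square_integrable g"
  shows "square_integrable (\<lambda>x. f x - g x)"
  using square_integrable_add[OF assms(1) square_integrable_scale[OF assms(2), of "-1"]] by simp

quotient_type 'n L2 = "real^'n::finite \<Rightarrow> real" / partial: L2_eq
proof (rule part_equivpI)
  show "\<exists>x. L2_eq x (x :: real^'n \<Rightarrow> real)"
    by (rule exI[of _ "\<lambda>x. 0"]) (simp add: L2_eq_def square_integrable_zero)
  show "symp (L2_eq :: (real^'n \<Rightarrow> real) \<Rightarrow> _)"
    by (auto simp: symp_def L2_eq_def)
  show "transp (L2_eq :: (real^'n \<Rightarrow> real) \<Rightarrow> _)"
    by (auto simp: transp_def L2_eq_def elim: AE_mp)
qed

instantiation L2 :: (finite) real_inner
begin

lift_definition zero_L2 :: "'a L2" is "\<lambda>x. 0"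
  by (simp add: L2_eq_def square_integrable_zero)

lift_definition plus_L2 :: "'a L2 \<Rightarrow> 'a L2 \<Rightarrow> 'a L2" is "\<lambda>f g x. f x + g x"
  by (auto simp: L2_eq_def square_integrable_add)

lift_definition minus_L2 :: "'a L2 \<Rightarrow> 'a L2 \<Rightarrow> 'a L2" is "\<lambda>f g x. f x - g x"
  by (auto simp: L2_eq_def square_integrable_diff)

lift_definition uminus_L2 :: "'a L2 \<Rightarrow> 'a L2" is "\<lambda>f x. - f x"
  using square_integrable_scale[of _ "-1"] by (auto simp: L2_eq_def)

lift_definition scaleR_L2 :: "real \<Rightarrow> 'a L2 \<Rightarrow> 'a L2" is "\<lambda>c f x. c * f x"
  by (auto simp: L2_eq_def square_integrable_scale)

lift_definition inner_L2 :: "'a L2 \<Rightarrow> 'a L2 \<Rightarrow> real" is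
  "\<lambda>f g. LINT x|lborel. f x * g x"
proof -
  fix f f' g g' :: "real^'a \<Rightarrow> real"
  assume *: "L2_eq f f'" "L2_eq g g'"
  show "(LINT x|lborel. f x * g x) = (LINT x|lborel. f' x * g' x)"
  proof (rule integral_cong_AE)
    show "AE x in lborel. f x * g x = f' x * g' x"
      using * by (auto simp: L2_eq_def)
  qed (use * in \<open>auto simp: L2_eq_def square_integrable_def intro!: borel_measurable_times\<close>)
qed

definition norm_L2 :: "'a L2 \<Rightarrow> real" where "norm_L2 f = sqrt (inner f f)"
definition dist_L2 :: "'a L2 \<Rightarrow> 'a L2 \<Rightarrow> real" where "dist_L2 f g = norm (f - g)"
definition sgn_L2 :: "'a L2 \<Rightarrow> 'a L2" where "sgn_L2 f = scaleR (inverse (norm f)) f"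
definition uniformity_L2 :: "('a L2 \<times> 'a L2) filter" where
  "uniformity_L2 = (INF e\<in>{0 <..}. principal {(x, y). dist x y < e})"
definition open_L2 :: "'a L2 set \<Rightarrow> bool" where
  "open_L2 S \<longleftrightarrow> (\<forall>x\<in>S. \<forall>\<^sub>F (x', y) in uniformity. x' = x \<longrightarrow> y \<in> S)"

instance
proof
  fix f g h :: "'a L2" and c d :: real
  show "f + g + h = f + (g + h)"
    by transfer (auto simp: L2_eq_def add.assoc intro!: square_integrable_add)
  show "f + g = g + f"
    by transfer (auto simp: L2_eq_def add.commute intro!: square_integrable_add)
  show "0 + f = f"
    by transfer (auto simp: L2_eq_def)
  show "- f + f = 0"
    by transfer (auto simp: L2_eq_def square_integrable_zero)
  show "f - g = f + - g"
    by transfer (auto simp: L2_eq_def intro!: square_integrable_diff)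
  show "c *\<^sub>R (f + g) = c *\<^sub>R f + c *\<^sub>R g"
    by transfer (auto simp: L2_eq_def distrib_left
        intro!: square_integrable_add square_integrable_scale)
  show "(c + d) *\<^sub>R f = c *\<^sub>R f + d *\<^sub>R f"
    by transfer (auto simp: L2_eq_def distrib_right
        intro!: square_integrable_add square_integrable_scale)
  show "c *\<^sub>R d *\<^sub>R f = (c * d) *\<^sub>R f"
    by transfer (auto simp: L2_eq_def mult.assoc intro!: square_integrable_scale)
  show "1 *\<^sub>R f = f"
    by transfer (auto simp: L2_eq_def)
  show "inner f g = inner g f"
    by transfer (simp add: mult.commute)
  show "inner (f + g) h = inner f h + inner g h"
    by transfer (simp add: L2_eq_def distrib_right square_integrable_mult)
  show "inner (c *\<^sub>R f) g = c * inner f g"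
    by transfer (simp add: mult.assoc)
  show "0 \<le> inner f f"
    by transfer simp
  show "inner f f = 0 \<longleftrightarrow> f = 0"
  proof transfer
    fix f :: "real^'a \<Rightarrow> real"
    assume f: "L2_eq f f"
    have "(LINT x|lborel. f x * f x) = 0 \<longleftrightarrow> (AE x in lborel. f x * f x = 0)"
      using f by (intro integral_nonneg_eq_0_iff_AE)
        (auto simp: L2_eq_def square_integrable_mult)
    then show "(LINT x|lborel. f x * f x) = 0 \<longleftrightarrow> L2_eq f (\<lambda>x. 0)"
      using f by (simp add: L2_eq_def square_integrable_zero)
  qed
  show "norm f = sqrt (inner f f)" by (fact norm_L2_def)
qed (fact dist_L2_def sgn_L2_def uniformity_L2_def open_L2_def)+

end


section \<open>The spaces \<open>H\<^sup>1(\<real>\<^sup>n)\<close> and \<open>H\<^sup>-\<^sup>1(\<real>\<^sup>n)\<close>\<close>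

text \<open>
  An element of \<open>H\<^sup>1\<close> is a function in \<open>L\<^sup>2\<close> together with its distributional gradient, which
  lies in \<open>L\<^sup>2\<close> too. The function determines the gradient, so this is the usual space \<open>H\<^sup>1\<close>, and
  the inner product of the product space \<open>L\<^sup>2 \<times> (L\<^sup>2)\<^sup>n\<close> restricts to the usual one,
  \<open>(u, v) + \<Sum>\<^sub>i (\<partial>\<^sub>i u, \<partial>\<^sub>i v)\<close>.
\<close>

definition weak_gradient :: "'n::finite L2 \<Rightarrow> ('n L2)^'n \<Rightarrow> bool" where
  "weak_gradient f g \<longleftrightarrow>
     (\<forall>\<psi> i. schwartz \<psi> \<longrightarrow>
        inner f (abs_L2 (partial_deriv i \<psi>)) = - inner (g $ i) (abs_L2 \<psi>))"

typedef 'n H1 = "{(f :: 'n::finite L2, g). weak_gradient f g}"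
  morphisms H1_pair Abs_H1
  by (rule exI[of _ "(0, 0)"]) (simp add: weak_gradient_def)

setup_lifting type_definition_H1

instantiation H1 :: (finite) real_inner
begin

lift_definition zero_H1 :: "'a H1" is "0"
  by (simp add: weak_gradient_def zero_prod_def)

lift_definition plus_H1 :: "'a H1 \<Rightarrow> 'a H1 \<Rightarrow> 'a H1" is "(+)"
  by (auto simp: weak_gradient_def inner_add_left)

lift_definition minus_H1 :: "'a H1 \<Rightarrow> 'a H1 \<Rightarrow> 'a H1" is "(-)"
  by (auto simp: weak_gradient_def inner_diff_left)

lift_definition uminus_H1 :: "'a H1 \<Rightarrow> 'a H1" is "uminus"
  by (auto simp: weak_gradient_def)

lift_definition scaleR_H1 :: "real \<Rightarrow> 'a H1 \<Rightarrow> 'a H1" is "scaleR"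
  by (auto simp: weak_gradient_def)

lift_definition inner_H1 :: "'a H1 \<Rightarrow> 'a H1 \<Rightarrow> real" is "inner" .

definition norm_H1 :: "'a H1 \<Rightarrow> real" where "norm_H1 f = sqrt (inner f f)"
definition dist_H1 :: "'a H1 \<Rightarrow> 'a H1 \<Rightarrow> real" where "dist_H1 f g = norm (f - g)"
definition sgn_H1 :: "'a H1 \<Rightarrow> 'a H1" where "sgn_H1 f = scaleR (inverse (norm f)) f"
definition uniformity_H1 :: "('a H1 \<times> 'a H1) filter" where
  "uniformity_H1 = (INF e\<in>{0 <..}. principal {(x, y). dist x y < e})"
definition open_H1 :: "'a H1 set \<Rightarrow> bool" where
  "open_H1 S \<longleftrightarrow> (\<forall>x\<in>S. \<forall>\<^sub>F (x', y) in uniformity. x' = x \<longrightarrow> y \<in> S)"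

instance
proof
  fix f g h :: "'a H1" and c d :: real
  show "f + g + h = f + (g + h)" by transfer (simp add: add.assoc)
  show "f + g = g + f" by transfer (simp add: add.commute)
  show "0 + f = f" by transfer simp
  show "- f + f = 0" by transfer simp
  show "f - g = f + - g" by transfer simp
  show "c *\<^sub>R (f + g) = c *\<^sub>R f + c *\<^sub>R g" by transfer (simp add: scaleR_right_distrib)
  show "(c + d) *\<^sub>R f = c *\<^sub>R f + d *\<^sub>R f" by transfer (simp add: scaleR_left_distrib)
  show "c *\<^sub>R d *\<^sub>R f = (c * d) *\<^sub>R f" by transfer simp
  show "1 *\<^sub>R f = f" by transfer simp
  show "inner f g = inner g f" by transfer (simp add: inner_commute)
  show "inner (f + g) h = inner f h + inner g h" by transfer (simp add: inner_add_left)
  show "inner (c *\<^sub>R f) g = c * inner f g" by transfer simp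
  show "0 \<le> inner f f" by transfer simp
  show "inner f f = 0 \<longleftrightarrow> f = 0" by transfer simp
  show "norm f = sqrt (inner f f)" by (fact norm_H1_def)
qed (fact dist_H1_def sgn_H1_def uniformity_H1_def open_H1_def)+

end

definition H1_L2 :: "'n::finite H1 \<Rightarrow> 'n L2" where
  "H1_L2 u = fst (H1_pair u)"

definition H1_grad :: "'n::finite H1 \<Rightarrow> ('n L2)^'n" where
  "H1_grad u = snd (H1_pair u)"

lemma inner_H1_eq: "inner u v = inner (H1_L2 u) (H1_L2 v) + inner (H1_grad u) (H1_grad v)"
  by (simp add: inner_H1.rep_eq inner_prod_def H1_L2_def H1_grad_def)

lemma bounded_linear_H1_L2: "bounded_linear H1_L2"
  by (rule bounded_linear_intro[where K = 1])
    (simp_all add: H1_L2_def plus_H1.rep_eq scaleR_H1.rep_eq norm_eq_sqrt_inner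
      inner_H1.rep_eq inner_prod_def)

lemma bounded_linear_H1_grad: "bounded_linear H1_grad"
  by (rule bounded_linear_intro[where K = 1])
    (simp_all add: H1_grad_def plus_H1.rep_eq scaleR_H1.rep_eq norm_eq_sqrt_inner
      inner_H1.rep_eq inner_prod_def)

type_synonym 'n Hm1 = "'n H1 \<Rightarrow>\<^sub>L real"

definition L2_Hm1 :: "'n::finite L2 \<Rightarrow> 'n Hm1" where
  "L2_Hm1 f = Blinfun (\<lambda>v. inner f (H1_L2 v))"

definition H1_laplace :: "'n::finite H1 \<Rightarrow> 'n Hm1" where
  "H1_laplace u = Blinfun (\<lambda>v. - inner (H1_grad u) (H1_grad v))"

lemma L2_Hm1_apply: "blinfun_apply (L2_Hm1 f) v = inner f (H1_L2 v)"
proof -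
  have "bounded_linear (\<lambda>v. inner f (H1_L2 v))"
    by (rule bounded_linear_compose[OF bounded_linear_inner_right bounded_linear_H1_L2])
  then show ?thesis
    unfolding L2_Hm1_def by (rule bounded_linear_Blinfun_apply[THEN fun_cong])
qed

lemma H1_laplace_apply: "blinfun_apply (H1_laplace u) v = - inner (H1_grad u) (H1_grad v)"
proof -
  have "bounded_linear (\<lambda>v. - inner (H1_grad u) (H1_grad v))"
    by (rule bounded_linear_minus[OF
          bounded_linear_compose[OF bounded_linear_inner_right bounded_linear_H1_grad]])
  then show ?thesis
    unfolding H1_laplace_def by (rule bounded_linear_Blinfun_apply[THEN fun_cong])
qed

text \<open>
  The function \<open>w\<close>, as a tempered distribution, is the element \<open>F\<close> of \<open>H\<^sup>-\<^sup>1\<close>. The variable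
  \<open>v\<close> is the Schwartz function \<open>\<psi>\<close> viewed as an element of \<open>H\<^sup>1\<close>.
\<close>

definition represents_Hm1 :: "(real^'n::finite \<Rightarrow> real) \<Rightarrow> 'n Hm1 \<Rightarrow> bool" where
  "represents_Hm1 w F \<longleftrightarrow>
     (\<forall>\<psi> v. schwartz \<psi> \<and> H1_L2 v = abs_L2 \<psi> \<longrightarrow>
        integrable lborel (\<lambda>x. w x * \<psi> x) \<and>
        blinfun_apply F v = (LINT x|lborel. w x * \<psi> x))"


section \<open>The damping coefficient\<close>

text \<open>Derivatives within \<open>{0..}\<close> are one-sided at \<open>0\<close>.\<close>

primrec half_line_deriv :: "nat \<Rightarrow> (real \<Rightarrow> real) \<Rightarrow> real \<Rightarrow> real" where
  "half_line_deriv 0 f = f"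
| "half_line_deriv (Suc k) f = (\<lambda>t. vector_derivative (half_line_deriv k f) (at t within {0..}))"

definition smooth_half_line :: "(real \<Rightarrow> real) \<Rightarrow> bool" where
  "smooth_half_line f \<longleftrightarrow>
     (\<forall>k. \<forall>t\<ge>0. half_line_deriv k f differentiable (at t within {0..}))"

definition admissible_damping ::
  "(real \<Rightarrow> real) \<Rightarrow> real \<Rightarrow> real \<Rightarrow> real \<Rightarrow> real \<Rightarrow> bool" where
  "admissible_damping b \<beta> b1 b2 b3 \<longleftrightarrow>
     smooth_half_line b \<and> (\<forall>t\<ge>0. b t > 0) \<and> b1 > 0 \<and> b2 > 0 \<and> b3 > 0 \<and>
     (\<forall>t\<ge>0. b1 * (1 + t) powr (-\<beta>) \<le> b t \<and> b t \<le> b2 * (1 + t) powr (-\<beta>)) \<and>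
     (\<forall>t\<ge>0. \<bar>half_line_deriv 1 b t\<bar> \<le> b3 * (1 + t) powr (-1) * b t)"

definition B_fun :: "(real \<Rightarrow> real) \<Rightarrow> real \<Rightarrow> real" where
  "B_fun b t = integral {0..t} (\<lambda>\<tau>. 1 / b \<tau>)"

definition B_inv :: "(real \<Rightarrow> real) \<Rightarrow> real \<Rightarrow> real" where
  "B_inv b = inv_into {0..} (B_fun b)"

definition mu :: "real \<Rightarrow> (real \<Rightarrow> real) \<Rightarrow> real \<Rightarrow> real \<Rightarrow> real \<Rightarrow> real \<Rightarrow> real \<Rightarrow> real" where
  "mu p b \<beta> b1 b3 B4 A =
     Min {1,
          (p - 1) / 2 * b 0 * A,
          inverse (2 * (p + 1) / (p - 1)\<^sup>2 * (1 / b1\<^sup>2) *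
                     (if \<beta> = -1 then 1
                      else (2 powr (1 / (1 + \<beta>)) * (1 + B4)) powr (max 0 (2 * \<beta>)))
                   + 2 * (b3 / b1 + 1) / (p - 1))}"


section \<open>Strong solutions\<close>

primrec C_on :: "nat \<Rightarrow> real set \<Rightarrow> (real \<Rightarrow> 'a::real_normed_vector) \<Rightarrow> bool" where
  "C_on 0 S f \<longleftrightarrow> continuous_on S f"
| "C_on (Suc k) S f \<longleftrightarrow>
     (\<exists>f'. (\<forall>t\<in>S. (f has_vector_derivative f' t) (at t within S)) \<and> C_on k S f')"

definition deriv_on :: "real set \<Rightarrow> (real \<Rightarrow> 'a::real_normed_vector) \<Rightarrow> real \<Rightarrow> 'a" where
  "deriv_on S f t = vector_derivative f (at t within S)"

definition time_interval :: "ereal \<Rightarrow> real set" where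
  "time_interval T = {t. 0 \<le> t \<and> ereal t < T}"

text \<open>
  The equation says that the function \<open>|u|\<^sup>p\<close> is the element \<open>u\<^sub>t\<^sub>t - \<Delta>u + b u\<^sub>t\<close> of \<open>H\<^sup>-\<^sup>1\<close>
  at every time; the latter is continuous in time by the regularity of \<open>u\<close>, hence so is \<open>|u|\<^sup>p\<close>.
\<close>

definition strong_solution ::
  "(real \<Rightarrow> real) \<Rightarrow> real \<Rightarrow> 'n::finite H1 \<Rightarrow> 'n L2 \<Rightarrow> ereal \<Rightarrow> (real \<Rightarrow> 'n H1) \<Rightarrow> bool" where
  "strong_solution b p u0 u1 T u \<longleftrightarrow>
     (let S = time_interval T;
          u_L2 = (\<lambda>t. H1_L2 (u t));
          u_Hm1 = (\<lambda>t. L2_Hm1 (u_L2 t))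
      in 0 < T \<and>
         C_on 2 S u_Hm1 \<and> C_on 1 S u_L2 \<and> C_on 0 S u \<and>
         u 0 = u0 \<and> deriv_on S u_L2 0 = u1 \<and>
         (\<forall>t\<in>S. represents_Hm1 (\<lambda>x. \<bar>rep_L2 (u_L2 t) x\<bar> powr p)
                  (deriv_on S (deriv_on S u_Hm1) t - H1_laplace (u t)
                     + b t *\<^sub>R deriv_on S u_Hm1 t)))"

definition lifespan ::
  "(real \<Rightarrow> real) \<Rightarrow> real \<Rightarrow> 'n::finite H1 \<Rightarrow> 'n L2 \<Rightarrow> (real \<Rightarrow> 'n H1) \<Rightarrow> ereal" where
  "lifespan b p u0 u1 u = Sup {T. 0 < T \<and> strong_solution b p u0 u1 T u}"


section \<open>Test function quantities\<close>

definition L1_norm :: "(real^'n::finite \<Rightarrow> real) \<Rightarrow> real" where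
  "L1_norm f = (LINT x|lborel. \<bar>f x\<bar>)"

definition conj_exp :: "real \<Rightarrow> real" where
  "conj_exp p = p / (p - 1)"

definition Phi :: "nat \<Rightarrow> (real^'n::finite \<Rightarrow> real) \<Rightarrow> real^'n \<Rightarrow> real" where
  "Phi l \<phi> x = real l * (real l - 1) * inner (gradient \<phi> x) (gradient \<phi> x)
                + real l * \<phi> x * laplacian \<phi> x"

definition A_const :: "real \<Rightarrow> nat \<Rightarrow> (real^'n::finite \<Rightarrow> real) \<Rightarrow> real" where
  "A_const p l \<phi> =
     (let p' = conj_exp p in
        2 powr (p' - 1) * p' powr (- 1 / p) * p powr ((1 - p') / p)
        * L1_norm (\<lambda>x. \<bar>Phi l \<phi> x\<bar> powr p' * \<phi> x powr (real l - 2 * p')) powr (1 / p)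
        * L1_norm (\<lambda>x. \<phi> x ^ l) powr (1 / p'))"

definition I_fun ::
  "nat \<Rightarrow> (real^'n::finite \<Rightarrow> real) \<Rightarrow> (real \<Rightarrow> 'n H1) \<Rightarrow> real \<Rightarrow> real" where
  "I_fun l \<phi> u t = (LINT x|lborel. rep_L2 (H1_L2 (u t)) x * \<phi> x ^ l)"

end

theory Submission
  imports Defs
begin

text \<open>
  Blow-up by the test function method. Let \<open>\<psi> = \<phi>\<^sup>l\<close> and let \<open>L\<close> be its integral. Pairing the equation
  with \<open>\<psi>\<close> gives, for the average \<open>I\<close> of the solution \<open>u\<close> against \<open>\<psi>\<close>,
  \<open>I'' + b I' = \<integral> |u|\<^sup>p \<psi> + \<integral> u \<Delta>\<psi>\<close> (\<open>strong_solution_tested\<close>). Since \<open>\<Delta>\<psi> = \<phi>\<^bsup>l-2\<^esup> \<Phi>\<close>, Young's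
  inequality absorbs the last term into one half of the nonlinearity up to a constant, and Jensen's
  inequality bounds the other half below by \<open>I\<^sup>p L\<^bsup>1-p\<^esup> / 2\<close>. The number \<open>A\<close> is such that the constant
  equals \<open>A\<^sup>p L\<^bsup>1-p\<^esup> / 2\<close>, and \<open>I\<^sup>p - A\<^sup>p \<ge> (I - A)\<^sup>p\<close> (\<open>tested_nonlinearity_lower_bound\<close>). So a
  multiple \<open>y\<close> of \<open>J = I - A\<close> satisfies \<open>y'' + b y' \<ge> y\<^sup>p\<close> wherever \<open>y \<ge> 0\<close>.

  What remains is an ordinary differential inequality. With \<open>\<epsilon> = y(0)\<close> and \<open>\<kappa> = \<mu> \<epsilon>\<^bsup>p-1\<^esup>\<close> the function
  \<open>F = \<epsilon> (1 - \<kappa> B)\<^bsup>-2/(p-1)\<^esup>\<close> has the same initial value, a smaller initial velocity, and satisfies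
  \<open>F'' + b F' \<le> F\<^sup>p\<close> up to its explosion at \<open>B = 1 / \<kappa>\<close>; the three terms in the minimum defining \<open>\<mu>\<close>
  are what this requires (\<open>subsolution_inequality\<close>, \<open>supersolution_ge_subsolution\<close>). The difference
  \<open>D = y - F\<close> then obeys \<open>D'' + b D' \<ge> 0\<close> wherever \<open>D > 0\<close>, which forces \<open>D\<close> to keep increasing
  (\<open>positive_velocity_persists\<close>). Hence \<open>y \<ge> F\<close>, and since \<open>y\<close> is continuous while \<open>F\<close> explodes, the
  solution cannot live beyond the explosion time (\<open>blow_up_time_not_reached\<close>).
\<close>

section \<open>Rapid decay and Schwartz functions\<close>

definition rapidly_decreasing :: "(real^'n::finite \<Rightarrow> real) \<Rightarrow> bool" where
  "rapidly_decreasing f \<longleftrightarrow> (\<forall>k. bounded (range (\<lambda>x. norm x ^ k * f x)))"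

lemma rapidly_decreasing_weighted_bound:
  fixes f :: "real^'n::finite \<Rightarrow> real"
  assumes "rapidly_decreasing f"
  obtains C where "C > 0" "\<And>x. \<bar>f x\<bar> \<le> C * inverse ((1 + norm x) ^ N)"
proof -
  obtain C0 where C0: "\<And>x. \<bar>norm x ^ 0 * f x\<bar> \<le> C0"
    using assms[unfolded rapidly_decreasing_def, rule_format, of 0]
    unfolding bounded_iff by auto
  obtain CN where CN: "\<And>x. \<bar>norm x ^ N * f x\<bar> \<le> CN"
    using assms[unfolded rapidly_decreasing_def, rule_format, of N]
    unfolding bounded_iff by auto
  define C where "C = 2 ^ N * (\<bar>C0\<bar> + \<bar>CN\<bar>) + 1"
  show ?thesis
  proof
    show "C > 0" unfolding C_def by (simp add: add_nonneg_pos)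
    fix x :: "real^'n"
    have "(1 + norm x) ^ N \<le> (2 * max 1 (norm x)) ^ N"
      by (rule power_mono) auto
    also have "\<dots> \<le> 2 ^ N * (1 + norm x ^ N)"
      unfolding power_mult_distrib by (auto simp: max_def)
    finally have "(1 + norm x) ^ N * \<bar>f x\<bar> \<le> 2 ^ N * (1 + norm x ^ N) * \<bar>f x\<bar>"
      by (rule mult_right_mono) simp
    also have "\<dots> = 2 ^ N * (\<bar>norm x ^ 0 * f x\<bar> + \<bar>norm x ^ N * f x\<bar>)"
      by (simp add: algebra_simps abs_mult)
    also have "\<dots> \<le> 2 ^ N * (\<bar>C0\<bar> + \<bar>CN\<bar>)"
      using C0[of x] CN[of x] by (intro mult_left_mono) auto
    also have "\<dots> \<le> C" unfolding C_def by simp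
    finally have *: "(1 + norm x) ^ N * \<bar>f x\<bar> \<le> C" .
    have "(1 + norm x) ^ N > 0"
      by (intro zero_less_power) (simp add: add_pos_nonneg)
    then show "\<bar>f x\<bar> \<le> C * inverse ((1 + norm x) ^ N)"
      using * by (simp add: field_simps)
  qed
qed

text \<open>On the shell \<open>k \<le> |x| < k + 1\<close> the function is at most \<open>(k + 1)\<^bsup>-n-2\<^esup>\<close>, and the ball that contains
  the shell has volume of order \<open>(k + 1)\<^sup>n\<close>, so the integral is dominated by a sum of inverse squares.\<close>

lemma integrable_inverse_norm_power:
  "integrable lborel (\<lambda>x::'a::euclidean_space. inverse ((1 + norm x) ^ (DIM('a) + 2)))"
proof (rule integrableI_bounded)
  let ?N = "DIM('a) + 2"
  let ?w = "\<lambda>x::'a. inverse ((1 + norm x) ^ ?N)"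
  let ?s = "\<lambda>k x. ennreal (inverse (real (Suc k) ^ ?N)) * indicator (ball (0::'a) (real (Suc k))) x"
  show "?w \<in> borel_measurable lborel" by measurable
  have le: "ennreal (norm (?w x)) \<le> (\<Sum>k. ?s k x)" for x :: 'a
  proof -
    define k where "k = nat \<lfloor>norm x\<rfloor>"
    have k: "real k \<le> norm x" "norm x < real (Suc k)"
      unfolding k_def by (simp_all, linarith)
    have "?w x \<le> inverse (real (Suc k) ^ ?N)"
      using k(1) by (intro le_imp_inverse_le power_mono) auto
    then have "ennreal (norm (?w x)) \<le> ?s k x"
      using k(2) by (simp add: ennreal_leI)
    also have "\<dots> = (\<Sum>k\<in>{k}. ?s k x)"
      by (simp only: sum.insert sum.empty finite.emptyI empty_iff not_False_eq_True add_0_right)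
    also have "\<dots> \<le> (\<Sum>k. ?s k x)"
      by (rule sum_le_suminf) auto
    finally show ?thesis .
  qed
  have "(\<integral>\<^sup>+x. ennreal (norm (?w x)) \<partial>lborel) \<le> (\<integral>\<^sup>+x. (\<Sum>k. ?s k x) \<partial>lborel)"
    by (intro nn_integral_mono le)
  also have "\<dots> = (\<Sum>k. \<integral>\<^sup>+x. ?s k x \<partial>lborel)"
    by (rule nn_integral_suminf) (auto intro!: borel_measurable_times_ennreal borel_measurable_indicator)
  also have "\<dots> = (\<Sum>k. ennreal (unit_ball_vol (real DIM('a)) * inverse (real (Suc k) ^ 2)))"
  proof (rule suminf_cong)
    fix k
    have "inverse (real (Suc k) ^ ?N) * (unit_ball_vol (real DIM('a)) * real (Suc k) ^ DIM('a))
        = unit_ball_vol (real DIM('a)) * inverse (real (Suc k) ^ 2)"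
      by (simp add: power_add field_simps power2_eq_square del: of_nat_Suc)
    then show "(\<integral>\<^sup>+x. ?s k x \<partial>lborel)
        = ennreal (unit_ball_vol (real DIM('a)) * inverse (real (Suc k) ^ 2))"
      by (simp add: nn_integral_cmult_indicator emeasure_ball ennreal_mult'[symmetric] del: of_nat_Suc)
  qed
  also have "\<dots> < \<infinity>"
  proof -
    have "summable (\<lambda>k. unit_ball_vol (real DIM('a)) * inverse (real (Suc k) ^ 2))"
      using inverse_power_summable[of 2, where 'a = real]
      by (intro summable_mult) (subst summable_Suc_iff, simp)
    then have "(\<Sum>k. ennreal (unit_ball_vol (real DIM('a)) * inverse (real (Suc k) ^ 2))) \<noteq> top"
      by (intro ennreal_suminf_neq_top) auto
    then show ?thesis by (simp add: less_top)
  qed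
  finally show "(\<integral>\<^sup>+x. ennreal (norm (?w x)) \<partial>lborel) < \<infinity>" .
qed

lemma rapidly_decreasing_integrable:
  fixes f :: "real^'n::finite \<Rightarrow> real"
  assumes "rapidly_decreasing f" "f \<in> borel_measurable lborel"
  shows "integrable lborel f"
proof -
  obtain C where C: "C > 0" "\<And>x. \<bar>f x\<bar> \<le> C * inverse ((1 + norm x) ^ (DIM(real^'n) + 2))"
    using rapidly_decreasing_weighted_bound[OF assms(1)] by blast
  show ?thesis
    by (rule Bochner_Integration.integrable_bound[OF
          integrable_mult_right[OF integrable_inverse_norm_power, of C]])
      (use C assms(2) in auto)
qed

lemma rapidly_decreasing_bounded:
  assumes "rapidly_decreasing f"
  obtains C where "C > 0" "\<And>x. \<bar>f x\<bar> \<le> C"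
  using rapidly_decreasing_weighted_bound[OF assms, of 0] by auto

lemma rapidly_decreasing_mult:
  assumes f: "rapidly_decreasing f" and g: "\<And>x. \<bar>g x\<bar> \<le> C"
  shows "rapidly_decreasing (\<lambda>x. f x * g x)"
  unfolding rapidly_decreasing_def
proof
  fix k
  obtain B where B: "\<And>x. \<bar>norm x ^ k * f x\<bar> \<le> B"
    using f[unfolded rapidly_decreasing_def, rule_format, of k] unfolding bounded_iff by auto
  have "norm (norm x ^ k * (f x * g x)) \<le> B * C" for x
  proof -
    have "\<bar>norm x ^ k * f x\<bar> * \<bar>g x\<bar> \<le> B * C"
      using B[of x] g[of x] by (intro mult_mono) auto
    then show ?thesis by (simp add: abs_mult mult.assoc)
  qed
  then show "bounded (range (\<lambda>x. norm x ^ k * (f x * g x)))"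
    unfolding bounded_iff by blast
qed

lemma rapidly_decreasing_add:
  assumes "rapidly_decreasing f" "rapidly_decreasing g"
  shows "rapidly_decreasing (\<lambda>x. f x + g x)"
  using assms unfolding rapidly_decreasing_def
  by (auto simp: distrib_left intro!: bounded_plus_comp)

lemma schwartz_differentiable: "schwartz f \<Longrightarrow> f differentiable (at x)"
  unfolding schwartz_def by (metis iter_partial.simps(1))

lemma schwartz_rapidly_decreasing: "schwartz f \<Longrightarrow> rapidly_decreasing f"
  unfolding schwartz_def rapidly_decreasing_def by (metis iter_partial.simps(1))

lemma iter_partial_snoc: "iter_partial (is @ [i]) f = iter_partial is (partial_deriv i f)"
  by (induction "is") auto

lemma schwartz_partial_deriv: "schwartz f \<Longrightarrow> schwartz (partial_deriv i f)"
  unfolding schwartz_def iter_partial_snoc[symmetric] by blast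

text \<open>Schwartz functions are the largest class of rapidly decreasing differentiable functions
  that is closed under partial derivatives.\<close>

lemma schwartz_coinduct:
  assumes "P f"
    and "\<And>f x. P f \<Longrightarrow> f differentiable (at x)"
    and "\<And>f. P f \<Longrightarrow> rapidly_decreasing f"
    and "\<And>f i. P f \<Longrightarrow> P (partial_deriv i f)"
  shows "schwartz f"
proof -
  have "P (iter_partial is f)" for "is"
    by (induction "is") (use assms(1,4) in auto)
  then show ?thesis
    using assms(2,3) unfolding schwartz_def rapidly_decreasing_def by blast
qed

lemma partial_deriv_eqI:
  assumes "(f has_derivative f') (at x)"
  shows "partial_deriv i f x = f' (axis i 1)"
  using frechet_derivative_at[OF assms] unfolding partial_deriv_def by simp

lemma partial_deriv_add:
  assumes "\<And>x. f differentiable (at x)" "\<And>x. g differentiable (at x)"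
  shows "partial_deriv i (\<lambda>x. f x + g x) = (\<lambda>x. partial_deriv i f x + partial_deriv i g x)"
proof
  fix x
  have "((\<lambda>x. f x + g x) has_derivative
      (\<lambda>h. frechet_derivative f (at x) h + frechet_derivative g (at x) h)) (at x)"
    using assms frechet_derivative_works by (intro has_derivative_add) blast+
  from partial_deriv_eqI[OF this, of i]
  show "partial_deriv i (\<lambda>x. f x + g x) x = partial_deriv i f x + partial_deriv i g x"
    by (simp add: partial_deriv_def)
qed

lemma partial_deriv_mult:
  assumes "\<And>x. f differentiable (at x)" "\<And>x. g differentiable (at x)"
  shows "partial_deriv i (\<lambda>x. f x * g x) =
    (\<lambda>x. f x * partial_deriv i g x + partial_deriv i f x * g x)"
proof
  fix x
  have "((\<lambda>x. f x * g x) has_derivative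
      (\<lambda>h. f x * frechet_derivative g (at x) h + frechet_derivative f (at x) h * g x)) (at x)"
    using assms frechet_derivative_works by (intro has_derivative_mult) blast+
  from partial_deriv_eqI[OF this, of i]
  show "partial_deriv i (\<lambda>x. f x * g x) x = f x * partial_deriv i g x + partial_deriv i f x * g x"
    by (simp add: partial_deriv_def)
qed

lemma schwartz_continuous_on: "schwartz f \<Longrightarrow> continuous_on UNIV f"
  by (simp add: continuous_at_imp_continuous_on differentiable_imp_continuous_within
      schwartz_differentiable)

lemma schwartz_measurable: "schwartz f \<Longrightarrow> f \<in> borel_measurable borel"
  by (intro borel_measurable_continuous_onI schwartz_continuous_on)

lemma schwartz_bounded:
  assumes "schwartz f" obtains C where "C > 0" "\<And>x. \<bar>f x\<bar> \<le> C"
  using rapidly_decreasing_bounded[OF schwartz_rapidly_decreasing[OF assms]] by blast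

lemma schwartz_integrable: "schwartz f \<Longrightarrow> integrable lborel f"
  by (simp add: rapidly_decreasing_integrable schwartz_rapidly_decreasing schwartz_measurable)

inductive sum_of_schwartz_products :: "(real^'n::finite \<Rightarrow> real) \<Rightarrow> bool" where
  product: "schwartz f \<Longrightarrow> schwartz g \<Longrightarrow> sum_of_schwartz_products (\<lambda>x. f x * g x)"
| sum: "sum_of_schwartz_products f \<Longrightarrow> sum_of_schwartz_products g \<Longrightarrow>
    sum_of_schwartz_products (\<lambda>x. f x + g x)"

text \<open>By the Leibniz rule the finite sums of products of two Schwartz functions are closed under
  partial derivatives.\<close>

lemma schwartz_mult:
  assumes "schwartz f" "schwartz g"
  shows "schwartz (\<lambda>x. f x * g x)"
proof (rule schwartz_coinduct[of sum_of_schwartz_products])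
  show "sum_of_schwartz_products (\<lambda>x. f x * g x)"
    using assms by (rule sum_of_schwartz_products.product)
next
  fix h :: "real^'a \<Rightarrow> real" and x
  assume "sum_of_schwartz_products h"
  then show "h differentiable (at x)"
    by induction (simp_all add: schwartz_differentiable)
next
  fix h :: "real^'a \<Rightarrow> real"
  assume "sum_of_schwartz_products h"
  then show "rapidly_decreasing h"
  proof induction
    case (product f g)
    then show ?case
      using schwartz_bounded[OF product(2)]
      by (metis rapidly_decreasing_mult schwartz_rapidly_decreasing)
  qed (rule rapidly_decreasing_add)
next
  fix h :: "real^'a \<Rightarrow> real" and i
  assume "sum_of_schwartz_products h"
  then have "(\<forall>x. h differentiable (at x)) \<and> sum_of_schwartz_products (partial_deriv i h)"
  proof induction
    case (product f g)
    then show ?case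
      by (auto simp: partial_deriv_mult schwartz_differentiable schwartz_partial_deriv
          intro!: sum_of_schwartz_products.intros derivative_intros)
  next
    case (sum f g)
    then show ?case
      by (auto simp: partial_deriv_add intro!: sum_of_schwartz_products.intros derivative_intros)
  qed
  then show "sum_of_schwartz_products (partial_deriv i h)" by blast
qed

lemma schwartz_add:
  assumes "schwartz f" "schwartz g"
  shows "schwartz (\<lambda>x. f x + g x)"
proof (rule schwartz_coinduct[of "\<lambda>h. \<exists>f g. schwartz f \<and> schwartz g \<and> h = (\<lambda>x. f x + g x)"])
  show "\<exists>f' g'. schwartz f' \<and> schwartz g' \<and> (\<lambda>x. f x + g x) = (\<lambda>x. f' x + g' x)"
    using assms by blast
next
  fix h :: "real^'a \<Rightarrow> real" and i
  assume "\<exists>f g. schwartz f \<and> schwartz g \<and> h = (\<lambda>x. f x + g x)"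
  then obtain f g where "schwartz f" "schwartz g" "h = (\<lambda>x. f x + g x)" by blast
  then have "schwartz (partial_deriv i f)" "schwartz (partial_deriv i g)"
    "partial_deriv i h = (\<lambda>x. partial_deriv i f x + partial_deriv i g x)"
    by (simp_all add: schwartz_partial_deriv partial_deriv_add schwartz_differentiable)
  then show "\<exists>f g. schwartz f \<and> schwartz g \<and> partial_deriv i h = (\<lambda>x. f x + g x)"
    by blast
qed (auto simp: schwartz_differentiable rapidly_decreasing_add schwartz_rapidly_decreasing)

lemma schwartz_power:
  assumes "schwartz f" "k > 0"
  shows "schwartz (\<lambda>x. f x ^ k)"
  using assms(2)
proof (induction k rule: nat_induct_non_zero)
  case 1
  then show ?case using assms(1) by simp
next
  case (Suc k)
  then show ?case using schwartz_mult[OF assms(1)] by simp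
qed

lemma schwartz_square_integrable: "schwartz f \<Longrightarrow> square_integrable f"
  using schwartz_integrable[OF schwartz_power[of f 2]]
  by (simp add: square_integrable_def schwartz_measurable)

text \<open>The integral of a difference quotient vanishes by translation invariance; the decay of the
  derivative, which survives translations of length at most one, dominates the passage to the
  limit.\<close>

lemma integral_partial_deriv_eq_0:
  fixes f :: "real^'n::finite \<Rightarrow> real"
  assumes "schwartz f"
  shows "(LINT x|lborel. partial_deriv i f x) = 0"
proof -
  let ?e = "axis i 1 :: real^'n"
  let ?N = "DIM(real^'n) + 2"
  define s where "s k x = real (Suc k) * (f (inverse (real (Suc k)) *\<^sub>R ?e + x) - f x)" for k x
  obtain C where C: "C > 0" "\<And>x. \<bar>partial_deriv i f x\<bar> \<le> C * inverse ((1 + norm x) ^ ?N)"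
    using rapidly_decreasing_weighted_bound[OF
        schwartz_rapidly_decreasing[OF schwartz_partial_deriv[OF assms]]] by blast
  let ?w = "\<lambda>x::real^'n. C * 2 ^ ?N * inverse ((1 + norm x) ^ ?N)"
  have line: "((\<lambda>h. f (h *\<^sub>R ?e + x)) has_real_derivative partial_deriv i f (h *\<^sub>R ?e + x)) (at h)"
    for h x
  proof -
    let ?D = "frechet_derivative f (at (h *\<^sub>R ?e + x))"
    have D: "(f has_derivative ?D) (at (h *\<^sub>R ?e + x))"
      using frechet_derivative_works schwartz_differentiable[OF assms] by blast
    have "((\<lambda>h. h *\<^sub>R ?e + x) has_derivative (\<lambda>k. k *\<^sub>R ?e)) (at h)"
      by (auto intro!: derivative_eq_intros)
    from diff_chain_at[OF this D] have "((\<lambda>h. f (h *\<^sub>R ?e + x)) has_derivative (\<lambda>k. ?D (k *\<^sub>R ?e))) (at h)"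
      by (simp add: o_def)
    then show ?thesis
      unfolding has_field_derivative_def partial_deriv_def
      by (simp add: linear_cmul[OF has_derivative_linear[OF D]] mult.commute[of _ "?D ?e"])
  qed
  have meas: "f \<in> borel_measurable borel" using assms by (rule schwartz_measurable)
  have lim: "(\<lambda>k. integral\<^sup>L lborel (s k)) \<longlonglongrightarrow> (LINT x|lborel. partial_deriv i f x)"
  proof (rule integral_dominated_convergence[where w = ?w])
    show "partial_deriv i f \<in> borel_measurable lborel"
      using schwartz_measurable[OF schwartz_partial_deriv[OF assms]] by simp
    show "s k \<in> borel_measurable lborel" for k
      unfolding s_def using meas by measurable
    show "integrable lborel ?w"
      by (intro integrable_mult_right integrable_inverse_norm_power)
    show "AE x in lborel. (\<lambda>k. s k x) \<longlonglongrightarrow> partial_deriv i f x"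
    proof (rule AE_I2)
      fix x
      have "((\<lambda>h. (f (h *\<^sub>R ?e + x) - f x) / h) \<longlongrightarrow> partial_deriv i f x) (at 0)"
        using line[of x 0] by (simp add: has_field_derivative_iff)
      moreover have "filterlim (\<lambda>k. inverse (real (Suc k))) (at 0) sequentially"
        unfolding filterlim_at using LIMSEQ_inverse_real_of_nat by simp
      ultimately show "(\<lambda>k. s k x) \<longlonglongrightarrow> partial_deriv i f x"
        unfolding s_def using filterlim_compose
        by (fastforce simp: divide_inverse mult.commute simp del: of_nat_Suc)
    qed
    show "AE x in lborel. norm (s k x) \<le> ?w x" for k
    proof (rule AE_I2)
      fix x
      have "0 < inverse (real (Suc k))" by simp
      from MVT2[OF this line, of x] obtain z where z: "0 < z" "z < inverse (real (Suc k))"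
        "f (inverse (real (Suc k)) *\<^sub>R ?e + x) - f (0 *\<^sub>R ?e + x)
          = (inverse (real (Suc k)) - 0) * partial_deriv i f (z *\<^sub>R ?e + x)" by blast
      have s: "s k x = partial_deriv i f (z *\<^sub>R ?e + x)"
        unfolding s_def using z(3) by (simp del: of_nat_Suc)
      have "inverse (real (Suc k)) \<le> 1" by (simp add: inverse_le_1_iff)
      then have "norm (z *\<^sub>R ?e) \<le> 1" using z by (simp add: norm_axis_1)
      moreover have "norm x \<le> norm (z *\<^sub>R ?e + x) + norm (z *\<^sub>R ?e)"
        using norm_triangle_ineq4[of "z *\<^sub>R ?e + x" "z *\<^sub>R ?e"] by simp
      ultimately have "1 + norm x \<le> 2 * (1 + norm (z *\<^sub>R ?e + x))"
        using norm_ge_zero[of "z *\<^sub>R ?e + x"] by argo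
      then have "(1 + norm x) ^ ?N \<le> 2 ^ ?N * (1 + norm (z *\<^sub>R ?e + x)) ^ ?N"
        unfolding power_mult_distrib[symmetric] by (intro power_mono) auto
      moreover have "(1 + norm x) ^ ?N > 0" "(1 + norm (z *\<^sub>R ?e + x)) ^ ?N > 0"
        by (intro zero_less_power add_pos_nonneg; simp)+
      ultimately have "inverse ((1 + norm (z *\<^sub>R ?e + x)) ^ ?N) \<le> 2 ^ ?N * inverse ((1 + norm x) ^ ?N)"
        by (simp add: field_simps del: power_Suc)
      then have "C * inverse ((1 + norm (z *\<^sub>R ?e + x)) ^ ?N) \<le> C * (2 ^ ?N * inverse ((1 + norm x) ^ ?N))"
        using C(1) by (intro mult_left_mono) auto
      then show "norm (s k x) \<le> ?w x"
        using C(2)[of "z *\<^sub>R ?e + x"] s by (simp add: mult.assoc)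
    qed
  qed
  have "integral\<^sup>L lborel (s k) = 0" for k
  proof -
    let ?c = "inverse (real (Suc k)) *\<^sub>R ?e"
    have int: "integrable lborel f" using assms by (rule schwartz_integrable)
    have shift: "integrable lborel (\<lambda>x. f (?c + x))" "(LINT x|lborel. f (?c + x)) = (LINT x|lborel. f x)"
      using integrable_distr_eq[of "(+) ?c" lborel borel f] integral_distr[of "(+) ?c" lborel borel f]
        int meas unfolding lborel_distr_plus by auto
    show ?thesis
      unfolding s_def using shift int by simp
  qed
  then show ?thesis
    using lim by (simp add: LIMSEQ_const_iff)
qed

lemma integral_by_parts_partial_deriv:
  assumes "schwartz f" "schwartz g"
  shows "(LINT x|lborel. f x * partial_deriv i g x) = - (LINT x|lborel. partial_deriv i f x * g x)"
proof -
  have "(LINT x|lborel. f x * partial_deriv i g x + partial_deriv i f x * g x) = 0"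
    using integral_partial_deriv_eq_0[OF schwartz_mult[OF assms], of i]
    by (simp add: partial_deriv_mult assms schwartz_differentiable)
  moreover have "integrable lborel (\<lambda>x. f x * partial_deriv i g x)"
    "integrable lborel (\<lambda>x. partial_deriv i f x * g x)"
    using assms by (auto intro!: schwartz_integrable schwartz_mult schwartz_partial_deriv)
  ultimately show ?thesis by simp
qed

section \<open>The test function\<close>

lemma schwartz_zero: "schwartz (\<lambda>x. 0)"
proof (rule schwartz_coinduct[of "\<lambda>f. f = (\<lambda>x. 0)"])
  fix f :: "real^'a \<Rightarrow> real" and i
  assume f: "f = (\<lambda>x. 0)"
  show "partial_deriv i f = (\<lambda>x. 0)"
    unfolding f using partial_deriv_eqI[OF has_derivative_const] by fastforce
qed (simp_all add: rapidly_decreasing_def)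

lemma schwartz_cmult:
  assumes "schwartz f"
  shows "schwartz (\<lambda>x. c * f x)"
proof (rule schwartz_coinduct[of "\<lambda>h. \<exists>f. schwartz f \<and> h = (\<lambda>x. c * f x)"])
  fix h :: "real^'a \<Rightarrow> real" and i
  assume "\<exists>f. schwartz f \<and> h = (\<lambda>x. c * f x)"
  then obtain f where f: "schwartz f" "h = (\<lambda>x. c * f x)" by blast
  have "partial_deriv i h = (\<lambda>x. c * partial_deriv i f x)"
    using partial_deriv_mult[of "\<lambda>x. c" f i] partial_deriv_eqI[OF has_derivative_const, of i c] f
    by (simp add: schwartz_differentiable)
  then show "\<exists>f. schwartz f \<and> partial_deriv i h = (\<lambda>x. c * f x)"
    using schwartz_partial_deriv[OF f(1)] by blast
next
  fix h :: "real^'a \<Rightarrow> real"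
  assume "\<exists>f. schwartz f \<and> h = (\<lambda>x. c * f x)"
  then show "rapidly_decreasing h"
    using rapidly_decreasing_mult[of _ "\<lambda>x. c" "\<bar>c\<bar>"] schwartz_rapidly_decreasing
    by (fastforce simp: mult.commute)
qed (use assms in \<open>auto simp: schwartz_differentiable\<close>)

lemma schwartz_sum: "(\<And>i. i \<in> A \<Longrightarrow> schwartz (f i)) \<Longrightarrow> schwartz (\<lambda>x. \<Sum>i\<in>A. f i x)"
  by (induction A rule: infinite_finite_induct) (auto intro: schwartz_add schwartz_zero)

lemma schwartz_laplacian: "schwartz f \<Longrightarrow> schwartz (laplacian f)"
  unfolding laplacian_def[abs_def] by (intro schwartz_sum schwartz_partial_deriv)

lemma schwartz_Phi:
  assumes "schwartz \<phi>"
  shows "schwartz (Phi l \<phi>)"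
proof -
  have "schwartz (\<lambda>x. real l * (real l - 1) * (\<Sum>i\<in>UNIV. partial_deriv i \<phi> x * partial_deriv i \<phi> x)
      + real l * (\<phi> x * laplacian \<phi> x))"
    using assms by (intro schwartz_add schwartz_cmult schwartz_sum schwartz_mult schwartz_partial_deriv
        schwartz_laplacian)
  then show ?thesis
    by (simp add: Phi_def[abs_def] inner_vec_def gradient_def mult.assoc)
qed

lemma partial_deriv_power:
  assumes "\<And>x. f differentiable (at x)"
  shows "partial_deriv i (\<lambda>x. f x ^ k) = (\<lambda>x. real k * f x ^ (k - 1) * partial_deriv i f x)"
proof
  fix x
  have "((\<lambda>x. f x ^ k) has_derivative
      (\<lambda>h. of_nat k * frechet_derivative f (at x) h * f x ^ (k - 1))) (at x)"
    using assms frechet_derivative_works by (intro has_derivative_power) blast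
  from partial_deriv_eqI[OF this, of i]
  show "partial_deriv i (\<lambda>x. f x ^ k) x = real k * f x ^ (k - 1) * partial_deriv i f x"
    by (simp add: partial_deriv_def)
qed

lemma laplacian_power:
  assumes \<phi>: "schwartz \<phi>" and l: "l \<ge> 2"
  shows "laplacian (\<lambda>x. \<phi> x ^ l) x = \<phi> x ^ (l - 2) * Phi l \<phi> x"
proof -
  have "partial_deriv i (partial_deriv i (\<lambda>x. \<phi> x ^ l)) x =
      \<phi> x ^ (l - 2) * (real l * (real l - 1) * (partial_deriv i \<phi> x * partial_deriv i \<phi> x)
        + real l * \<phi> x * partial_deriv i (partial_deriv i \<phi>) x)" for i
  proof -
    have d: "schwartz (\<lambda>x. \<phi> x ^ (l - 1))" "schwartz (partial_deriv i \<phi>)"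
      using l \<phi> by (auto intro: schwartz_power schwartz_partial_deriv)
    have "partial_deriv i (\<lambda>x. \<phi> x ^ l) = (\<lambda>x. (real l * \<phi> x ^ (l - 1)) * partial_deriv i \<phi> x)"
      by (rule partial_deriv_power) (rule schwartz_differentiable[OF \<phi>])
    then have "partial_deriv i (partial_deriv i (\<lambda>x. \<phi> x ^ l)) x =
       real l * \<phi> x ^ (l - 1) * partial_deriv i (partial_deriv i \<phi>) x
       + partial_deriv i (\<lambda>x. real l * \<phi> x ^ (l - 1)) x * partial_deriv i \<phi> x"
      using partial_deriv_mult[of "\<lambda>x. real l * \<phi> x ^ (l - 1)" "partial_deriv i \<phi>" i] d
      by (simp add: schwartz_differentiable)
    also have "partial_deriv i (\<lambda>x. real l * \<phi> x ^ (l - 1)) x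
        = real l * (real (l - 1) * \<phi> x ^ (l - 1 - 1) * partial_deriv i \<phi> x)"
      using partial_deriv_mult[of "\<lambda>x. real l" "\<lambda>x. \<phi> x ^ (l - 1)" i] d(1) \<phi>
        partial_deriv_eqI[OF has_derivative_const, of i "real l"]
      by (simp add: schwartz_differentiable partial_deriv_power)
    also have "l - 1 - 1 = l - 2" by simp
    also have "\<phi> x ^ (l - 1) = \<phi> x ^ (l - 2) * \<phi> x"
      using l by (simp add: power_Suc2[symmetric] del: power_Suc)
        (metis One_nat_def Suc_diff_Suc Suc_le_lessD numeral_2_eq_2)
    also have "real (l - 1) = real l - 1" using l by simp
    finally show ?thesis by (simp add: algebra_simps)
  qed
  then show ?thesis
    unfolding laplacian_def Phi_def inner_vec_def gradient_def
    by (simp add: sum.distrib sum_distrib_left[symmetric])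
qed

section \<open>The equation tested against a Schwartz function\<close>

lemma square_integrable_rep_L2: "square_integrable (rep_L2 f)"
  using Quotient3_rep_reflp[OF Quotient3_L2, of f] by (simp add: L2_eq_def)

lemma inner_abs_L2:
  assumes "square_integrable f" "square_integrable g"
  shows "inner (abs_L2 f) (abs_L2 g) = (LINT x|lborel. f x * g x)"
  using assms by (intro inner_L2.abs_eq) (auto simp: L2_eq_def)

lemma inner_abs_L2_right:
  assumes "square_integrable g"
  shows "inner f (abs_L2 g) = (LINT x|lborel. rep_L2 f x * g x)"
  using inner_abs_L2[OF square_integrable_rep_L2 assms] Quotient3_abs_rep[OF Quotient3_L2] by metis

lemma schwartz_as_H1:
  assumes "schwartz \<psi>"
  obtains v where "H1_L2 v = abs_L2 \<psi>" "\<And>i. H1_grad v $ i = abs_L2 (partial_deriv i \<psi>)"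
proof -
  have "weak_gradient (abs_L2 \<psi>) (\<chi> i. abs_L2 (partial_deriv i \<psi>))"
    unfolding weak_gradient_def
    using assms by (auto simp: inner_abs_L2 schwartz_square_integrable schwartz_partial_deriv
        integral_by_parts_partial_deriv)
  then have "H1_pair (Abs_H1 (abs_L2 \<psi>, \<chi> i. abs_L2 (partial_deriv i \<psi>)))
      = (abs_L2 \<psi>, \<chi> i. abs_L2 (partial_deriv i \<psi>))"
    by (simp add: Abs_H1_inverse)
  then show ?thesis
    by (intro that[of "Abs_H1 (abs_L2 \<psi>, \<chi> i. abs_L2 (partial_deriv i \<psi>))"])
      (simp_all add: H1_L2_def H1_grad_def)
qed

lemma inner_H1_grad_schwartz:
  assumes \<psi>: "schwartz \<psi>" and v: "\<And>i. H1_grad v $ i = abs_L2 (partial_deriv i \<psi>)"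
  shows "inner (H1_grad u) (H1_grad v) = - (LINT x|lborel. rep_L2 (H1_L2 u) x * laplacian \<psi> x)"
proof -
  have "weak_gradient (H1_L2 u) (H1_grad u)"
    using H1_pair[of u] by (auto simp: H1_L2_def H1_grad_def)
  then have g: "inner (H1_grad u $ i) (abs_L2 (partial_deriv i \<psi>))
      = - inner (H1_L2 u) (abs_L2 (partial_deriv i (partial_deriv i \<psi>)))" for i
    unfolding weak_gradient_def using schwartz_partial_deriv[OF \<psi>] by fastforce
  have sq: "square_integrable (partial_deriv i (partial_deriv i \<psi>))" for i
    by (intro schwartz_square_integrable schwartz_partial_deriv \<psi>)
  have "inner (H1_grad u) (H1_grad v)
      = - (\<Sum>i\<in>UNIV. LINT x|lborel. rep_L2 (H1_L2 u) x * partial_deriv i (partial_deriv i \<psi>) x)"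
    by (simp add: inner_vec_def v g inner_abs_L2_right sq sum_negf)
  also have "\<dots> = - (LINT x|lborel. rep_L2 (H1_L2 u) x * laplacian \<psi> x)"
    unfolding laplacian_def sum_distrib_left
    by (subst Bochner_Integration.integral_sum)
      (auto intro: square_integrable_mult square_integrable_rep_L2 sq)
  finally show ?thesis .
qed

lemma time_interval_nontrivial:
  assumes "t \<in> time_interval T"
  shows "at t within time_interval T \<noteq> bot"
proof -
  obtain c where c: "ereal t < ereal c" "ereal c < T"
    using assms ereal_dense2 unfolding time_interval_def by blast
  then have "{t..c} \<subseteq> time_interval T"
    using assms unfolding time_interval_def
    by (auto intro: order.strict_trans1[of _ "ereal c"])
  then have "at t within {t..c} \<le> at t within time_interval T"
    by (rule at_le)
  moreover have "at t within {t..c} \<noteq> bot"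
    using c(1) by (simp add: at_within_Icc_at_right)
  ultimately show ?thesis by (metis bot.extremum_uniqueI)
qed

lemma deriv_on_eqI:
  assumes "(f has_vector_derivative f') (at t within time_interval T)" "t \<in> time_interval T"
  shows "deriv_on (time_interval T) f t = f'"
  unfolding deriv_on_def using vector_derivative_within time_interval_nontrivial assms by blast

text \<open>A strong solution is twice differentiable only as a curve in \<open>H\<^sup>-\<^sup>1\<close>, but a Schwartz function
  is a continuous functional there, and it takes the Laplacian off the solution.\<close>

lemma strong_solution_tested:
  fixes u :: "real \<Rightarrow> 'n::finite H1"
  assumes sol: "strong_solution b p u0 u1 T u" and \<psi>: "schwartz \<psi>"
  defines "I \<equiv> \<lambda>t. LINT x|lborel. rep_L2 (H1_L2 (u t)) x * \<psi> x"
  obtains I1 I2 where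
    "\<And>t. t \<in> time_interval T \<Longrightarrow> (I has_real_derivative I1 t) (at t within time_interval T)"
    "\<And>t. t \<in> time_interval T \<Longrightarrow> (I1 has_real_derivative I2 t) (at t within time_interval T)"
    "\<And>t. t \<in> time_interval T \<Longrightarrow> integrable lborel (\<lambda>x. \<bar>rep_L2 (H1_L2 (u t)) x\<bar> powr p * \<psi> x)"
    "\<And>t. t \<in> time_interval T \<Longrightarrow> I2 t + b t * I1 t =
       (LINT x|lborel. \<bar>rep_L2 (H1_L2 (u t)) x\<bar> powr p * \<psi> x)
       + (LINT x|lborel. rep_L2 (H1_L2 (u t)) x * laplacian \<psi> x)"
proof -
  let ?S = "time_interval T"
  let ?U = "\<lambda>t. L2_Hm1 (H1_L2 (u t))"
  obtain v where v: "H1_L2 v = abs_L2 \<psi>" "\<And>i. H1_grad v $ i = abs_L2 (partial_deriv i \<psi>)"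
    using schwartz_as_H1[OF \<psi>] by blast
  have "C_on 2 ?S ?U" using sol by (simp add: strong_solution_def Let_def)
  then obtain U1 U2 where U1: "\<And>t. t \<in> ?S \<Longrightarrow> (?U has_vector_derivative U1 t) (at t within ?S)"
    and U2: "\<And>t. t \<in> ?S \<Longrightarrow> (U1 has_vector_derivative U2 t) (at t within ?S)"
    by (auto simp: numeral_2_eq_2)
  have I: "I t = blinfun_apply (?U t) v" for t
    unfolding I_def by (simp add: L2_Hm1_apply v inner_abs_L2_right schwartz_square_integrable \<psi>)
  have dU: "deriv_on ?S ?U t = U1 t" if "t \<in> ?S" for t
    using deriv_on_eqI[OF U1] that by blast
  have ddU: "deriv_on ?S (deriv_on ?S ?U) t = U2 t" if "t \<in> ?S" for t
  proof (rule deriv_on_eqI[OF _ that])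
    show "(deriv_on ?S ?U has_vector_derivative U2 t) (at t within ?S)"
      by (rule has_vector_derivative_transform[OF that dU U2[OF that]])
  qed
  have test: "((\<lambda>t. blinfun_apply (f t) v) has_real_derivative blinfun_apply f' v) (at t within ?S)"
    if "(f has_vector_derivative f') (at t within ?S)" for f f' t
    unfolding has_real_derivative_iff_has_vector_derivative
    by (rule bounded_linear.has_vector_derivative[OF blinfun.bounded_linear_left that])
  show ?thesis
  proof (rule that[of "\<lambda>t. blinfun_apply (U1 t) v" "\<lambda>t. blinfun_apply (U2 t) v"])
    fix t assume t: "t \<in> ?S"
    show "(I has_real_derivative blinfun_apply (U1 t) v) (at t within ?S)"
      unfolding I by (rule test[OF U1[OF t]])
    show "((\<lambda>t. blinfun_apply (U1 t) v) has_real_derivative blinfun_apply (U2 t) v) (at t within ?S)"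
      by (rule test[OF U2[OF t]])
    have "represents_Hm1 (\<lambda>x. \<bar>rep_L2 (H1_L2 (u t)) x\<bar> powr p)
        (deriv_on ?S (deriv_on ?S ?U) t - H1_laplace (u t) + b t *\<^sub>R deriv_on ?S ?U t)"
      using sol t unfolding strong_solution_def Let_def by blast
    then have "represents_Hm1 (\<lambda>x. \<bar>rep_L2 (H1_L2 (u t)) x\<bar> powr p)
        (U2 t - H1_laplace (u t) + b t *\<^sub>R U1 t)"
      unfolding dU[OF t] ddU[OF t] .
    then have rep: "integrable lborel (\<lambda>x. \<bar>rep_L2 (H1_L2 (u t)) x\<bar> powr p * \<psi> x)"
      "blinfun_apply (U2 t - H1_laplace (u t) + b t *\<^sub>R U1 t) v
        = (LINT x|lborel. \<bar>rep_L2 (H1_L2 (u t)) x\<bar> powr p * \<psi> x)"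
      unfolding represents_Hm1_def using \<psi> v(1) by blast+
    show "integrable lborel (\<lambda>x. \<bar>rep_L2 (H1_L2 (u t)) x\<bar> powr p * \<psi> x)" by (fact rep(1))
    show "blinfun_apply (U2 t) v + b t * blinfun_apply (U1 t) v =
       (LINT x|lborel. \<bar>rep_L2 (H1_L2 (u t)) x\<bar> powr p * \<psi> x)
       + (LINT x|lborel. rep_L2 (H1_L2 (u t)) x * laplacian \<psi> x)"
      using rep(2) inner_H1_grad_schwartz[OF \<psi> v(2), of "u t"]
      by (simp add: blinfun.diff_left blinfun.add_left blinfun.scaleR_left H1_laplace_apply)
  qed
qed

section \<open>The differential inequality for the tested solution\<close>

lemma powr_superadditive:
  fixes a b p :: real
  assumes "a \<ge> 0" "b \<ge> 0" "p \<ge> 1"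
  shows "a powr p + b powr p \<le> (a + b) powr p"
proof -
  have split: "x powr p = x * x powr (p - 1)" if "x \<ge> 0" for x
    using that powr_mult_base[of x "p - 1"] by simp
  have "a * a powr (p - 1) + b * b powr (p - 1) \<le> a * (a + b) powr (p - 1) + b * (a + b) powr (p - 1)"
    using assms by (intro add_mono mult_left_mono powr_mono2) auto
  also have "\<dots> = (a + b) * (a + b) powr (p - 1)" by (simp add: algebra_simps)
  finally show ?thesis using assms split by simp
qed

lemma powr_tangent:
  fixes a c p :: real
  assumes "a \<ge> 0" "c \<ge> 0" "p > 1"
  shows "c powr p + p * c powr (p - 1) * (a - c) \<le> a powr p"
proof -
  let ?q = "p / (p - 1)"
  have "a * c powr (p - 1) \<le> a powr p / p + (c powr (p - 1)) powr ?q / ?q"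
    using assms by (intro Youngs_inequality) (auto simp: field_simps)
  also have "(c powr (p - 1)) powr ?q = c powr p"
    using assms by (simp add: powr_powr)
  finally have "p * c powr (p - 1) * a \<le> a powr p + (p - 1) * c powr p"
    using assms by (simp add: field_simps)
  moreover have "c powr (p - 1) * c = c powr p"
    using assms powr_mult_base[of c "p - 1"] by (simp add: mult.commute)
  ultimately show ?thesis by (simp add: algebra_simps)
qed

text \<open>Jensen's inequality for the measure with density \<open>w\<close>: integrate the tangent of the power
  at the mean value.\<close>

lemma weighted_Jensen_powr:
  fixes f w :: "'a \<Rightarrow> real" and p L :: real
  assumes p: "p > 1" and w: "integrable M w" "\<And>x. w x \<ge> 0"
    and L: "L = (LINT x|M. w x)" "L > 0"
    and f: "integrable M (\<lambda>x. \<bar>f x\<bar> * w x)" "integrable M (\<lambda>x. \<bar>f x\<bar> powr p * w x)"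
  shows "L powr (1 - p) * (LINT x|M. \<bar>f x\<bar> * w x) powr p \<le> (LINT x|M. \<bar>f x\<bar> powr p * w x)"
proof -
  define c where "c = (LINT x|M. \<bar>f x\<bar> * w x) / L"
  have c: "c \<ge> 0" unfolding c_def using w L by (simp add: integral_nonneg_AE)
  have cL: "c * L = (LINT x|M. \<bar>f x\<bar> * w x)" unfolding c_def using L by simp
  let ?k = "p * c powr (p - 1)"
  have "(LINT x|M. (c powr p - ?k * c) * w x + ?k * (\<bar>f x\<bar> * w x)) \<le> (LINT x|M. \<bar>f x\<bar> powr p * w x)"
  proof (rule integral_mono)
    fix x
    have "(c powr p + ?k * (\<bar>f x\<bar> - c)) * w x \<le> \<bar>f x\<bar> powr p * w x"
      using powr_tangent[of "\<bar>f x\<bar>" c p] c p w(2) by (intro mult_right_mono) auto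
    then show "(c powr p - ?k * c) * w x + ?k * (\<bar>f x\<bar> * w x) \<le> \<bar>f x\<bar> powr p * w x"
      by (simp add: algebra_simps)
  qed (use w f in auto)
  also have "(LINT x|M. (c powr p - ?k * c) * w x + ?k * (\<bar>f x\<bar> * w x))
      = (c powr p - ?k * c) * L + ?k * (c * L)"
    using w f L(1) cL by simp
  also have "\<dots> = c powr p * L" by (simp add: algebra_simps)
  finally have "c powr p * L \<le> (LINT x|M. \<bar>f x\<bar> powr p * w x)" .
  moreover have "c powr p * L = L powr (1 - p) * (LINT x|M. \<bar>f x\<bar> * w x) powr p"
    unfolding cL[symmetric] using c L(2) by (simp add: powr_mult powr_diff)
  ultimately show ?thesis by simp
qed

text \<open>The least \<open>K\<close> with \<open>a c \<le> a\<^sup>p / 2 + K c\<^sup>q\<close> for all \<open>a, c \<ge> 0\<close>, where \<open>q\<close> is the conjugate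
  exponent of \<open>p\<close>.\<close>

definition Young_const :: "real \<Rightarrow> real" where
  "Young_const p = 2 powr (conj_exp p - 1) / conj_exp p * p powr (1 - conj_exp p)"

text \<open>The factor \<open>s\<^bsup>l/p\<^esup>\<close> of \<open>s\<^bsup>l-2\<^esup>\<close> goes with \<open>a\<close>, and what is left goes with \<open>c\<close>. The constant
  \<open>(p/2)\<^bsup>1/p\<^esup>\<close>, moved from one side to the other, turns the coefficient \<open>1/p\<close> of Young's inequality
  into \<open>1/2\<close>.\<close>

lemma weighted_Young:
  assumes p: "p > 1" and l: "real l > 2 * conj_exp p" and "a \<ge> 0" "c \<ge> 0" "s \<ge> 0"
  shows "a * s ^ (l - 2) * c \<le>
    1 / 2 * (a powr p * s ^ l) + Young_const p * (c powr conj_exp p * s powr (real l - 2 * conj_exp p))"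
proof -
  let ?q = "conj_exp p"
  have q: "?q > 1" "1 / p + 1 / ?q = 1" "?q / p = ?q - 1"
    using p by (auto simp: conj_exp_def field_simps)
  have l2: "real l > 2" "l > 2" using l q by auto
  show ?thesis
  proof (cases "s = 0")
    case True
    then show ?thesis using l2 assms by (simp add: power_0_left)
  next
    case False
    then have s: "s > 0" using assms by simp
    define X where "X = (p / 2) powr (1 / p) * (a * s powr (real l / p))"
    define Y where "Y = (p / 2) powr (- 1 / p) * (c * s powr (real l - 2 - real l / p))"
    have "s ^ (l - 2) = s powr (real l / p) * s powr (real l - 2 - real l / p)"
      using s l2 by (simp add: powr_add[symmetric] powr_realpow[symmetric])
    moreover have "(p / 2) powr (1 / p) * (p / 2) powr (- 1 / p) = 1"
      using p by (simp add: powr_add[symmetric])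
    ultimately have XY: "a * s ^ (l - 2) * c = X * Y"
      unfolding X_def Y_def by (simp add: algebra_simps)
    have Xp: "X powr p / p = 1 / 2 * (a powr p * s ^ l)"
      unfolding X_def using p s assms
      by (simp add: powr_mult powr_powr powr_realpow)
    have "(real l - 2 - real l / p) * ?q = real l * (?q - ?q / p) - 2 * ?q"
      by (simp add: algebra_simps)
    then have e1: "(real l - 2 - real l / p) * ?q = real l - 2 * ?q" using q(3) by simp
    have e2: "- 1 / p * ?q = 1 - ?q" using q(3) by simp
    have "((p / 2) powr (- 1 / p)) powr ?q = (p / 2) powr (1 - ?q)"
      by (simp only: powr_powr e2)
    also have "\<dots> = p powr (1 - ?q) / 2 powr (1 - ?q)"
      by (rule powr_divide)
    also have "\<dots> = p powr (1 - ?q) * 2 powr (?q - 1)"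
      using powr_minus[of 2 "1 - ?q"] by (simp add: divide_inverse)
    finally have e3: "((p / 2) powr (- 1 / p)) powr ?q = p powr (1 - ?q) * 2 powr (?q - 1)" .
    have Yq: "Y powr ?q / ?q = Young_const p * (c powr ?q * s powr (real l - 2 * ?q))"
      unfolding Y_def Young_const_def using p s assms(4)
      by (simp only: powr_mult powr_ge_zero mult_nonneg_nonneg e3)
        (simp add: powr_powr e1 powr_mult)
    have "X * Y \<le> X powr p / p + Y powr ?q / ?q"
      using p q assms s by (intro Youngs_inequality) (auto simp: X_def Y_def)
    then show ?thesis unfolding XY Xp Yq .
  qed
qed

lemma A_const_nonneg: "A_const p l \<phi> \<ge> 0"
  unfolding A_const_def Let_def by simp

lemma A_const_powr:
  fixes \<phi> :: "real^'n::finite \<Rightarrow> real"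
  assumes p: "p > 1"
  shows "A_const p l \<phi> powr p = 2 * Young_const p *
    L1_norm (\<lambda>x. \<bar>Phi l \<phi> x\<bar> powr conj_exp p * \<phi> x powr (real l - 2 * conj_exp p))
    * L1_norm (\<lambda>x. \<phi> x ^ l) powr (p - 1)"
proof -
  let ?q = "conj_exp p"
  have q: "?q > 1" "(?q - 1) * p = ?q" "p / ?q = p - 1"
    using p by (auto simp: conj_exp_def field_simps)
  have N: "L1_norm f \<ge> 0" for f :: "real^'n \<Rightarrow> real"
    unfolding L1_norm_def by simp
  have "(2::real) powr ?q = 2 * 2 powr (?q - 1)" by (simp add: powr_diff)
  moreover have "?q powr (-1) = 1 / ?q" using q by (simp add: powr_minus divide_inverse)
  ultimately show ?thesis
    unfolding A_const_def Let_def Young_const_def using p q N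
    by (simp add: powr_mult powr_powr abs_of_nonneg)
qed

text \<open>One half of the nonlinearity absorbs the elliptic term at the price of a constant. Jensen's
  inequality bounds the other half from below by a power of the average, and by superadditivity of
  that power the surplus over \<open>A_const\<close> survives while the rest pays for the constant.\<close>

lemma tested_nonlinearity_lower_bound:
  fixes \<phi> U :: "real^'n::finite \<Rightarrow> real"
  assumes p: "p > 1" and l: "real l > 2 * conj_exp p"
    and \<phi>: "schwartz \<phi>" "\<And>x. \<phi> x \<ge> 0"
    and L: "L1_norm (\<lambda>x. \<phi> x ^ l) > 0"
    and U: "square_integrable U" "integrable lborel (\<lambda>x. \<bar>U x\<bar> powr p * \<phi> x ^ l)"
    and I: "A_const p l \<phi> \<le> (LINT x|lborel. U x * \<phi> x ^ l)" (is "_ \<le> ?I")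
  shows "1 / 2 * L1_norm (\<lambda>x. \<phi> x ^ l) powr (1 - p) * (?I - A_const p l \<phi>) powr p
    \<le> (LINT x|lborel. \<bar>U x\<bar> powr p * \<phi> x ^ l) + (LINT x|lborel. U x * laplacian (\<lambda>x. \<phi> x ^ l) x)"
proof -
  let ?L = "L1_norm (\<lambda>x. \<phi> x ^ l)" and ?q = "conj_exp p" and ?A = "A_const p l \<phi>"
  let ?F = "LINT x|lborel. \<bar>U x\<bar> powr p * \<phi> x ^ l"
  let ?h = "\<lambda>x. \<bar>Phi l \<phi> x\<bar> powr ?q * \<phi> x powr (real l - 2 * ?q)"
  have q: "?q > 1" using p by (simp add: conj_exp_def field_simps)
  then have l2: "l > 2" using l by simp
  have \<psi>: "schwartz (\<lambda>x. \<phi> x ^ l)" using l2 by (intro schwartz_power \<phi>) simp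
  have Um: "U \<in> borel_measurable borel" using U(1) by (simp add: square_integrable_def)
  have LU: "integrable lborel (\<lambda>x. U x * \<phi> x ^ l)"
    by (intro square_integrable_mult U schwartz_square_integrable \<psi>)
  then have LU': "integrable lborel (\<lambda>x. \<bar>U x\<bar> * \<phi> x ^ l)"
    using integrable_abs[OF LU] \<phi>(2) by (simp add: abs_mult)

  have h: "integrable lborel ?h"
  proof -
    obtain C where C: "\<And>x. \<bar>Phi l \<phi> x\<bar> \<le> C" using schwartz_bounded[OF schwartz_Phi[OF \<phi>(1)]] by blast
    obtain D where D: "\<And>x. \<bar>\<phi> x\<bar> \<le> D" using schwartz_bounded[OF \<phi>(1)] by blast
    have le: "\<bar>?h x\<bar> \<le> \<bar>C powr (?q - 1) * D powr (real l - 2 * ?q) * Phi l \<phi> x\<bar>" for x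
    proof -
      have "\<bar>Phi l \<phi> x\<bar> powr ?q = \<bar>Phi l \<phi> x\<bar> powr (?q - 1) * \<bar>Phi l \<phi> x\<bar>"
        using powr_mult_base[of "\<bar>Phi l \<phi> x\<bar>" "?q - 1"] by (simp add: mult.commute)
      also have "\<dots> \<le> C powr (?q - 1) * \<bar>Phi l \<phi> x\<bar>"
        using C[of x] q by (intro mult_right_mono powr_mono2) auto
      finally have "\<bar>Phi l \<phi> x\<bar> powr ?q \<le> C powr (?q - 1) * \<bar>Phi l \<phi> x\<bar>" .
      moreover have "\<phi> x powr (real l - 2 * ?q) \<le> D powr (real l - 2 * ?q)"
        using D[of x] \<phi>(2)[of x] l by (intro powr_mono2) auto
      ultimately have "?h x \<le> (C powr (?q - 1) * \<bar>Phi l \<phi> x\<bar>) * D powr (real l - 2 * ?q)"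
        by (intro mult_mono) auto
      then show ?thesis by (simp add: abs_mult mult_ac)
    qed
    show ?thesis
    proof (rule Bochner_Integration.integrable_bound)
      show "integrable lborel (\<lambda>x. C powr (?q - 1) * D powr (real l - 2 * ?q) * Phi l \<phi> x)"
        by (intro integrable_mult_right schwartz_integrable schwartz_Phi \<phi>)
      show "?h \<in> borel_measurable lborel"
        using schwartz_measurable[OF schwartz_Phi[OF \<phi>(1)]] schwartz_measurable[OF \<phi>(1)]
        by measurable
    qed (use le in simp)
  qed
  have hN: "L1_norm ?h = (LINT x|lborel. ?h x)" unfolding L1_norm_def by (simp add: abs_mult)

  have lap: "integrable lborel (\<lambda>x. U x * laplacian (\<lambda>x. \<phi> x ^ l) x)"
    by (intro square_integrable_mult U schwartz_square_integrable schwartz_laplacian \<psi>)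
  have "- (LINT x|lborel. U x * laplacian (\<lambda>x. \<phi> x ^ l) x)
      = (LINT x|lborel. - (U x * laplacian (\<lambda>x. \<phi> x ^ l) x))" by simp
  also have "\<dots> \<le> (LINT x|lborel. 1 / 2 * (\<bar>U x\<bar> powr p * \<phi> x ^ l) + Young_const p * ?h x)"
  proof (rule integral_mono)
    fix x
    have "- (U x * laplacian (\<lambda>x. \<phi> x ^ l) x) \<le> \<bar>U x * laplacian (\<lambda>x. \<phi> x ^ l) x\<bar>" by simp
    also have "\<dots> = \<bar>U x\<bar> * \<phi> x ^ (l - 2) * \<bar>Phi l \<phi> x\<bar>"
      using l2 \<phi> by (simp add: laplacian_power abs_mult)
    also have "\<dots> \<le> 1 / 2 * (\<bar>U x\<bar> powr p * \<phi> x ^ l) + Young_const p * ?h x"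
      using \<phi> by (intro weighted_Young p l) auto
    finally show "- (U x * laplacian (\<lambda>x. \<phi> x ^ l) x) \<le> \<dots>" .
  qed (use lap U(2) h in auto)
  also have "\<dots> = 1 / 2 * ?F + Young_const p * L1_norm ?h"
    unfolding hN using U(2) h by simp
  finally have young: "- (LINT x|lborel. U x * laplacian (\<lambda>x. \<phi> x ^ l) x)
    \<le> 1 / 2 * ?F + Young_const p * L1_norm ?h" .

  have "?L powr (p - 1) * ?L powr (1 - p) = 1"
    using L by (simp add: powr_add[symmetric])
  then have K: "Young_const p * L1_norm ?h = 1 / 2 * ?L powr (1 - p) * ?A powr p"
    unfolding A_const_powr[OF p] by (simp add: field_simps)

  have A: "0 \<le> ?A" by (rule A_const_nonneg)
  have "(?I - ?A) powr p + ?A powr p \<le> ?I powr p"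
    using powr_superadditive[of "?I - ?A" ?A p] A I p by simp
  also have "\<dots> \<le> (LINT x|lborel. \<bar>U x\<bar> * \<phi> x ^ l) powr p"
  proof (rule powr_mono2)
    show "?I \<le> (LINT x|lborel. \<bar>U x\<bar> * \<phi> x ^ l)"
      using LU LU' \<phi>(2) by (intro integral_mono mult_right_mono) auto
  qed (use A I p in auto)
  finally have "?L powr (1 - p) * ((?I - ?A) powr p + ?A powr p)
      \<le> ?L powr (1 - p) * (LINT x|lborel. \<bar>U x\<bar> * \<phi> x ^ l) powr p"
    by (intro mult_left_mono) auto
  also have "\<dots> \<le> ?F"
  proof (rule weighted_Jensen_powr[OF p _ _ _ L LU' U(2)])
    show "?L = (LINT x|lborel. \<phi> x ^ l)" unfolding L1_norm_def using \<phi>(2) by simp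
  qed (use \<phi>(2) schwartz_integrable[OF \<psi>] in auto)
  finally show ?thesis using young K by (simp add: algebra_simps)
qed

section \<open>The reparametrised time\<close>

lemma MVT_within:
  fixes f :: "real \<Rightarrow> real"
  assumes "a < c" "\<And>t. t \<in> {a..c} \<Longrightarrow> (f has_real_derivative f' t) (at t within {a..c})"
  obtains x where "a < x" "x < c" "f c - f a = (c - a) * f' x"
proof -
  have cont: "continuous_on {a..c} f"
    by (rule DERIV_continuous_on[OF assms(2)])
  have der: "(f has_derivative (\<lambda>h. f' x * h)) (at x)" if "a < x" "x < c" for x
    using assms(2)[of x] that at_within_Icc_at[of a x c] by (simp add: has_field_derivative_def)
  obtain x where "a < x" "x < c" "f c - f a = f' x * (c - a)"
    by (rule mvt[OF assms(1) cont der])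
  then show ?thesis using that by (simp add: mult.commute)
qed

lemma damping_pos: "admissible_damping b \<beta> b1 b2 b3 \<Longrightarrow> t \<ge> 0 \<Longrightarrow> b t > 0"
  by (simp add: admissible_damping_def)

lemma damping_bounds:
  assumes "admissible_damping b \<beta> b1 b2 b3" "t \<ge> 0"
  shows "b1 * (1 + t) powr (-\<beta>) \<le> b t" "b t \<le> b2 * (1 + t) powr (-\<beta>)"
    "\<bar>half_line_deriv 1 b t\<bar> \<le> b3 * (1 + t) powr (-1) * b t"
  using assms unfolding admissible_damping_def by blast+

lemma damping_constants_pos:
  assumes "admissible_damping b \<beta> b1 b2 b3"
  shows "b1 > 0" "b2 > 0" "b3 > 0"
  using assms unfolding admissible_damping_def by blast+

lemma damping_deriv:
  assumes "admissible_damping b \<beta> b1 b2 b3" "t \<ge> 0"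
  shows "(b has_real_derivative half_line_deriv 1 b t) (at t within {0..})"
proof -
  have "half_line_deriv 0 b differentiable (at t within {0..})"
    using assms unfolding admissible_damping_def smooth_half_line_def by blast
  then show ?thesis
    by (simp add: has_real_derivative_iff_has_vector_derivative vector_derivative_works)
qed

lemma damping_continuous_on:
  assumes "admissible_damping b \<beta> b1 b2 b3"
  shows "continuous_on {0..c} b"
proof (rule continuous_on_subset)
  show "continuous_on {0..} b"
    by (rule DERIV_continuous_on[OF damping_deriv[OF assms]]) simp
qed auto

lemma B_fun_0 [simp]: "B_fun b 0 = 0"
  by (simp add: B_fun_def)

lemma B_fun_deriv:
  assumes "admissible_damping b \<beta> b1 b2 b3" "t \<in> {0..c}"
  shows "(B_fun b has_real_derivative 1 / b t) (at t within {0..c})"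
proof -
  have "b \<tau> \<noteq> 0" if "\<tau> \<in> {0..c}" for \<tau>
    using damping_pos[OF assms(1), of \<tau>] that by simp
  then have "continuous_on {0..c} (\<lambda>\<tau>. 1 / b \<tau>)"
    using damping_continuous_on[OF assms(1)] by (intro continuous_intros) auto
  from integral_has_real_derivative[OF this assms(2)] show ?thesis
    by (simp add: B_fun_def[abs_def])
qed

lemma B_fun_strict_mono:
  assumes b: "admissible_damping b \<beta> b1 b2 b3" and "0 \<le> s" "s < t"
  shows "B_fun b s < B_fun b t"
proof -
  have d: "(B_fun b has_real_derivative 1 / b \<tau>) (at \<tau> within {s..t})" if "\<tau> \<in> {s..t}" for \<tau>
    by (rule DERIV_subset[OF B_fun_deriv[OF b, of \<tau> t]]) (use that assms(2) in auto)
  obtain x where x: "s < x" "x < t" "B_fun b t - B_fun b s = (t - s) * (1 / b x)"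
    by (rule MVT_within[of s t "B_fun b" "\<lambda>\<tau>. 1 / b \<tau>", OF assms(3) d])
  have "b x > 0" using damping_pos[OF b] x(1) assms(2) by simp
  then have "B_fun b t - B_fun b s > 0" unfolding x(3) using assms(3) by simp
  then show ?thesis by simp
qed

text \<open>As \<open>\<beta> \<ge> -1\<close>, the reciprocal of \<open>b\<close> decays at most like \<open>1 / t\<close>. The logarithm is what makes
  the reparametrised time cover the whole half-line.\<close>

lemma B_fun_ge_ln:
  assumes b: "admissible_damping b \<beta> b1 b2 b3" and "-1 \<le> \<beta>" "0 \<le> t"
  shows "ln (1 + t) / b2 \<le> B_fun b t"
proof (cases "t = 0")
  case False
  then have t: "0 < t" using assms by simp
  have b2: "b2 > 0" using damping_constants_pos[OF b] by simp
  have d: "((\<lambda>\<tau>. B_fun b \<tau> - ln (1 + \<tau>) / b2) has_real_derivative 1 / b \<tau> - 1 / (1 + \<tau>) / b2)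
      (at \<tau> within {0..t})" if "\<tau> \<in> {0..t}" for \<tau>
    using that b2 by (auto intro!: derivative_eq_intros B_fun_deriv[OF b])
  obtain x where x: "0 < x" "x < t"
    "B_fun b t - ln (1 + t) / b2 - (B_fun b 0 - ln (1 + 0) / b2) = (t - 0) * (1 / b x - 1 / (1 + x) / b2)"
    by (rule MVT_within[of 0 t "\<lambda>\<tau>. B_fun b \<tau> - ln (1 + \<tau>) / b2"
          "\<lambda>\<tau>. 1 / b \<tau> - 1 / (1 + \<tau>) / b2", OF t d])
  have bx: "b x > 0" "b x \<le> b2 * (1 + x) powr (-\<beta>)"
    using damping_pos[OF b] damping_bounds(2)[OF b] x(1) by simp_all
  note bx(2)
  also have "(1 + x) powr (-\<beta>) \<le> (1 + x) powr 1"
    using assms(2) x(1) by (intro powr_mono) auto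
  finally have "b x \<le> b2 * (1 + x)" using b2 x(1) by simp
  then have "1 / (b2 * (1 + x)) \<le> 1 / b x"
    using bx(1) by (intro divide_left_mono) auto
  then have "(t - 0) * (1 / b x - 1 / (1 + x) / b2) \<ge> 0"
    using t by (simp add: mult.commute)
  then show ?thesis using x(3) by simp
qed simp

lemma B_inv_properties:
  assumes b: "admissible_damping b \<beta> b1 b2 b3" and "-1 \<le> \<beta>"
  shows B_inv_B_fun: "0 \<le> t \<Longrightarrow> B_inv b (B_fun b t) = t"
    and B_fun_B_inv: "0 \<le> \<tau> \<Longrightarrow> B_fun b (B_inv b \<tau>) = \<tau>"
    and B_inv_nonneg: "0 \<le> \<tau> \<Longrightarrow> 0 \<le> B_inv b \<tau>"
proof -
  have "inj_on (B_fun b) {0..}"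
    by (rule strict_mono_on_imp_inj_on) (simp add: strict_mono_on_def B_fun_strict_mono[OF b])
  then show "0 \<le> t \<Longrightarrow> B_inv b (B_fun b t) = t"
    unfolding B_inv_def by (intro inv_into_f_f) auto
  have b2: "b2 > 0" using damping_constants_pos[OF b] by simp
  have *: "\<tau> \<in> B_fun b ` {0..}" if "0 \<le> \<tau>" for \<tau>
  proof -
    define c where "c = exp (b2 * \<tau>) - 1"
    have c: "0 \<le> c" unfolding c_def using that b2 by simp
    have "\<tau> \<le> B_fun b c"
      using B_fun_ge_ln[OF b assms(2) c] b2 unfolding c_def by simp
    moreover have "continuous_on {0..c} (B_fun b)"
      by (rule DERIV_continuous_on[OF B_fun_deriv[OF b]])
    ultimately obtain x where "0 \<le> x" "B_fun b x = \<tau>"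
      using IVT'[of "B_fun b" 0 \<tau> c] \<open>0 \<le> \<tau>\<close> c by auto
    then show ?thesis by auto
  qed
  show "0 \<le> \<tau> \<Longrightarrow> B_fun b (B_inv b \<tau>) = \<tau>"
    unfolding B_inv_def using * by (intro f_inv_into_f)
  show "0 \<le> \<tau> \<Longrightarrow> 0 \<le> B_inv b \<tau>"
    unfolding B_inv_def using inv_into_into[OF *] by simp
qed

section \<open>Comparison with an explicit subsolution\<close>

text \<open>As long as \<open>D\<close> increases it stays positive, and then \<open>exp (M t) D'\<close>, where \<open>M\<close> bounds
  the damping, is nondecreasing; so \<open>D'\<close> has no first zero.\<close>

lemma positive_velocity_persists:
  fixes D D1 D2 b :: "real \<Rightarrow> real"
  assumes D: "\<And>t. t \<in> {0..c} \<Longrightarrow> (D has_real_derivative D1 t) (at t within {0..c})"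
    and D1: "\<And>t. t \<in> {0..c} \<Longrightarrow> (D1 has_real_derivative D2 t) (at t within {0..c})"
    and bM: "\<And>t. t \<in> {0..c} \<Longrightarrow> b t \<le> M"
    and init: "D 0 = 0" "D1 0 > 0"
    and ineq: "\<And>t. t \<in> {0..c} \<Longrightarrow> D t > 0 \<Longrightarrow> D2 t + b t * D1 t \<ge> 0"
    and c: "c > 0"
  shows "D c > 0"
proof -
  have inc: "D t > 0" if t: "0 < t" "t \<le> c" and pos: "\<And>s. 0 < s \<Longrightarrow> s < t \<Longrightarrow> D1 s > 0" for t
  proof -
    have d: "(D has_real_derivative D1 s) (at s within {0..t})" if "s \<in> {0..t}" for s
      by (rule DERIV_subset[OF D]) (use that t in auto)
    obtain x where "0 < x" "x < t" "D t - D 0 = (t - 0) * D1 x"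
      by (rule MVT_within[of 0 t D D1, OF t(1) d])
    then show ?thesis using pos t init by simp
  qed
  have "D1 t > 0" if "t \<in> {0..c}" for t
  proof (rule ccontr)
    assume "\<not> D1 t > 0"
    define Z where "Z = {t \<in> {0..c}. D1 t \<le> 0}"
    have "continuous_on {0..c} D1" by (rule DERIV_continuous_on[OF D1])
    then have "closed Z"
      unfolding Z_def using continuous_on_closed_Collect_le[of "{0..c}" D1 "\<lambda>_. 0"] by auto
    have "bounded Z"
      by (rule bounded_subset[of "{0..c}"]) (auto simp: Z_def)
    have "compact Z" using \<open>closed Z\<close> \<open>bounded Z\<close> by (simp add: compact_eq_bounded_closed)
    have "Z \<noteq> {}" using that \<open>\<not> D1 t > 0\<close> unfolding Z_def by auto
    obtain s where s: "s \<in> Z" "\<And>t. t \<in> Z \<Longrightarrow> s \<le> t"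
      using compact_attains_inf[OF \<open>compact Z\<close> \<open>Z \<noteq> {}\<close>] by blast
    have "s \<noteq> 0" using s(1) init(2) unfolding Z_def by auto
    then have s0: "0 < s" "s \<le> c" "D1 s \<le> 0" using s(1) unfolding Z_def by simp_all
    have pos: "D1 x > 0" if "0 < x" "x < s" for x
      using s(2)[of x] that s0(2) unfolding Z_def by (simp add: not_less[symmetric]) argo
    have d: "((\<lambda>t. exp (M * t) * D1 t) has_real_derivative exp (M * x) * (D2 x + M * D1 x))
        (at x within {0..s})" if "x \<in> {0..s}" for x
    proof -
      have "(D1 has_real_derivative D2 x) (at x within {0..s})"
        by (rule DERIV_subset[OF D1]) (use that s0 in auto)
      then show ?thesis
        by (auto intro!: derivative_eq_intros simp: algebra_simps)
    qed
    obtain x where x: "0 < x" "x < s"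
      "exp (M * s) * D1 s - exp (M * 0) * D1 0 = (s - 0) * (exp (M * x) * (D2 x + M * D1 x))"
      by (rule MVT_within[of 0 s "\<lambda>t. exp (M * t) * D1 t"
          "\<lambda>t. exp (M * t) * (D2 t + M * D1 t)", OF s0(1) d])
    have "D x > 0" using inc[of x] x s0 pos by simp
    then have "0 \<le> D2 x + b x * D1 x" using ineq x s0 by auto
    also have "\<dots> \<le> D2 x + M * D1 x"
      using bM[of x] pos[of x] x s0 by (simp add: mult_right_mono)
    finally have "0 \<le> (s - 0) * (exp (M * x) * (D2 x + M * D1 x))" using s0(1) by simp
    then have "exp (M * s) * D1 s \<ge> D1 0" unfolding x(3)[symmetric] by simp
    moreover have "exp (M * s) * D1 s \<le> 0"
      using s0(3) by (simp add: mult_nonneg_nonpos)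
    ultimately show False using init by simp
  qed
  then show ?thesis using inc c by auto
qed

text \<open>For \<open>\<beta> > 0\<close> the growth of \<open>1 / b\<^sup>2\<close>, of order \<open>(1 + t)\<^bsup>2\<beta>\<^esup>\<close>, is paid for by the factor \<open>\<kappa>\<close>:
  while \<open>\<kappa> B \<le> 1\<close> the time \<open>1 + t\<close> is at most of order \<open>\<kappa>\<^bsup>-1/(1+\<beta>)\<^esup>\<close>, and \<open>2 \<beta> / (1 + \<beta>) \<le> 1\<close>
  because \<open>\<beta> \<le> 1\<close>.\<close>

lemma damping_quotient_bound:
  assumes b: "admissible_damping b \<beta> b1 b2 b3" and beta: "-1 \<le> \<beta>" "\<beta> \<le> 1"
    and B4: "B4 > 0" "\<beta> > -1 \<Longrightarrow> \<forall>\<tau>\<ge>0. B_inv b \<tau> \<le> B4 * (1 + \<tau>) powr (1 / (1 + \<beta>))"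
    and \<kappa>: "0 < \<kappa>" "\<kappa> \<le> 1" and t: "0 \<le> t" "\<kappa> * B_fun b t \<le> 1"
  shows "\<kappa> / (b t)\<^sup>2 \<le> 1 / b1\<^sup>2 *
    (if \<beta> = -1 then 1 else (2 powr (1 / (1 + \<beta>)) * (1 + B4)) powr (max 0 (2 * \<beta>)))"
    (is "_ \<le> 1 / b1\<^sup>2 * ?C")
proof -
  have b1: "b1 > 0" and bt: "b1 * (1 + t) powr (-\<beta>) \<le> b t"
    using damping_constants_pos[OF b] damping_bounds(1)[OF b t(1)] by simp_all
  have C: "\<kappa> * (1 + t) powr (2 * \<beta>) \<le> ?C"
  proof (cases "\<beta> \<le> 0")
    case True
    have "(1 + t) powr (2 * \<beta>) \<le> (1 + t) powr 0"
      using True t by (intro powr_mono) auto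
    then have "\<kappa> * (1 + t) powr (2 * \<beta>) \<le> 1 * 1"
      using \<kappa> t by (intro mult_mono) auto
    moreover have "?C = 1" using True B4(1) by (auto simp: max_def)
    ultimately show ?thesis by simp
  next
    case False
    let ?r = "1 / (1 + \<beta>)"
    let ?K = "2 powr ?r * (1 + B4)"
    have K: "?K > 0" using B4 by simp
    have B: "0 \<le> B_fun b t"
      using B_fun_strict_mono[OF b, of 0 t] t(1) by (cases "t = 0") auto
    have "B_fun b t \<le> 1 / \<kappa>" using t(2) \<kappa>(1) by (simp add: field_simps)
    moreover have k1: "1 \<le> 1 / \<kappa>" using \<kappa> by simp
    ultimately have "1 + B_fun b t \<le> 2 / \<kappa>" by simp
    then have "(1 + B_fun b t) powr ?r \<le> (2 / \<kappa>) powr ?r"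
      using False B by (intro powr_mono2) auto
    have "t = B_inv b (B_fun b t)" using B_inv_B_fun[OF b beta(1) t(1)] by simp
    also have "\<dots> \<le> B4 * (1 + B_fun b t) powr ?r" using B4(2) B False by simp
    also have "\<dots> \<le> B4 * (2 / \<kappa>) powr ?r"
      using \<open>(1 + B_fun b t) powr ?r \<le> (2 / \<kappa>) powr ?r\<close> B4(1) by simp
    finally have "t \<le> B4 * (2 / \<kappa>) powr ?r" .
    moreover have "1 \<le> (2 / \<kappa>) powr ?r"
      using k1 False by (intro ge_one_powr_ge_zero) auto
    ultimately have "1 + t \<le> (1 + B4) * (2 / \<kappa>) powr ?r" by (simp add: distrib_right)
    also have "\<dots> = ?K * \<kappa> powr (-?r)"
      by (simp add: powr_divide powr_minus_divide)
    finally have "(1 + t) powr (2 * \<beta>) \<le> (?K * \<kappa> powr (-?r)) powr (2 * \<beta>)"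
      using t(1) False by (intro powr_mono2) auto
    also have "\<dots> = ?K powr (2 * \<beta>) * \<kappa> powr (- ?r * (2 * \<beta>))"
      using K by (simp add: powr_mult powr_powr)
    finally have "\<kappa> * (1 + t) powr (2 * \<beta>) \<le> \<kappa> * (?K powr (2 * \<beta>) * \<kappa> powr (- ?r * (2 * \<beta>)))"
      using \<kappa> by simp
    also have "\<dots> = ?K powr (2 * \<beta>) * \<kappa> powr (1 - ?r * (2 * \<beta>))"
      using \<kappa>(1) by (simp add: powr_diff powr_minus_divide)
    also have "\<dots> \<le> ?K powr (2 * \<beta>) * 1"
      using \<kappa> False beta by (intro mult_left_mono powr_le1) (auto simp: field_simps)
    finally have "\<kappa> * (1 + t) powr (2 * \<beta>) \<le> ?K powr (2 * \<beta>)" by simp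
    then show ?thesis using False by (simp add: max_def)
  qed
  have "\<kappa> / (b t)\<^sup>2 \<le> \<kappa> / (b1 * (1 + t) powr (-\<beta>))\<^sup>2"
    using bt b1 t(1) \<kappa> damping_pos[OF b t(1)]
    by (intro divide_left_mono power_mono mult_pos_pos zero_less_power) auto
  also have "\<dots> = 1 / b1\<^sup>2 * (\<kappa> * (1 + t) powr (2 * \<beta>))"
  proof -
    have "((1 + t) powr (-\<beta>))\<^sup>2 = inverse ((1 + t) powr (2 * \<beta>))"
      by (simp add: power2_eq_square powr_add[symmetric] powr_minus[symmetric])
    then show ?thesis by (simp add: power_mult_distrib divide_inverse)
  qed
  also have "\<dots> \<le> 1 / b1\<^sup>2 * ?C"
    using C by (intro mult_left_mono) auto
  finally show ?thesis .
qed

lemma inverse_damping_deriv_bound: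
  assumes b: "admissible_damping b \<beta> b1 b2 b3" and "\<beta> \<le> 1" "0 \<le> t"
  shows "\<bar>half_line_deriv 1 b t / (b t)\<^sup>2\<bar> \<le> b3 / b1"
proof -
  have h: "\<bar>half_line_deriv 1 b t\<bar> \<le> b3 * (1 + t) powr (-1) * b t" "b1 > 0" "b3 > 0" "b t > 0"
    "b1 * (1 + t) powr (-\<beta>) \<le> b t"
    using damping_constants_pos[OF b] damping_bounds[OF b assms(3)] damping_pos[OF b assms(3)]
    by simp_all
  have "(1 + t) powr (-1) \<le> (1 + t) powr (-\<beta>)"
    using assms by (intro powr_mono) auto
  then have "b1 * (1 + t) powr (-1) \<le> b t"
    using mult_left_mono[of "(1 + t) powr (-1)" "(1 + t) powr (-\<beta>)" b1] h(2,5) by simp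
  then have "(1 + t) powr (-1) \<le> b t / b1" using h(2) by (simp add: field_simps)
  then have "b3 * (1 + t) powr (-1) * b t \<le> b3 * (b t / b1) * b t"
    using h by (intro mult_right_mono mult_left_mono) auto
  then have "\<bar>half_line_deriv 1 b t\<bar> \<le> b3 / b1 * (b t)\<^sup>2"
    using h(1) by (simp add: power2_eq_square)
  then show ?thesis using h(4) by (simp add: pos_divide_le_eq)
qed

lemma mu_bounds:
  assumes b: "admissible_damping b \<beta> b1 b2 b3" and p: "p > 1" and B4: "B4 > 0" and A: "A > 0"
  defines "m \<equiv> mu p b \<beta> b1 b3 B4 A"
    and "K \<equiv> 1 / b1\<^sup>2 *
      (if \<beta> = -1 then 1 else (2 powr (1 / (1 + \<beta>)) * (1 + B4)) powr (max 0 (2 * \<beta>)))"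
  shows "0 < m" "m \<le> 1" "m \<le> (p - 1) / 2 * b 0 * A"
    "m * (2 / (p - 1) * (1 + b3 / b1 + (p + 1) / (p - 1) * K)) \<le> 1"
proof -
  let ?E = "2 * (p + 1) / (p - 1)\<^sup>2 * (1 / b1\<^sup>2) *
      (if \<beta> = -1 then 1 else (2 powr (1 / (1 + \<beta>)) * (1 + B4)) powr (max 0 (2 * \<beta>)))
      + 2 * (b3 / b1 + 1) / (p - 1)"
  have E: "?E = 2 / (p - 1) * (1 + b3 / b1 + (p + 1) / (p - 1) * K)"
  proof -
    have "2 * q / d\<^sup>2 * w + 2 * (r + 1) / d = 2 / d * (1 + r + q / d * w)"
      if "d \<noteq> 0" for d q w r :: real
      using that by (simp add: power2_eq_square field_simps)
    from this[of "p - 1" "p + 1"] show ?thesis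
      unfolding K_def using p by (simp only: mult.assoc)
  qed
  define E where "E = 2 / (p - 1) * (1 + b3 / b1 + (p + 1) / (p - 1) * K)"
  have "K \<ge> 0" unfolding K_def by simp
  then have E0: "E > 0"
    unfolding E_def using p damping_constants_pos[OF b] by (intro mult_pos_pos add_pos_nonneg) auto
  have m: "m = min 1 (min ((p - 1) / 2 * b 0 * A) (inverse E))"
    unfolding m_def mu_def E E_def by simp
  show "0 < m"
    unfolding m using p A damping_pos[OF b, of 0] E0 by simp
  show "m \<le> 1" "m \<le> (p - 1) / 2 * b 0 * A" unfolding m by simp_all
  have "m \<le> inverse E" unfolding m by simp
  then have "m * E \<le> 1" using E0 by (simp add: field_simps)
  then show "m * (2 / (p - 1) * (1 + b3 / b1 + (p + 1) / (p - 1) * K)) \<le> 1"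
    unfolding E_def .
qed

text \<open>The exponent \<open>a = 2 / (p - 1)\<close> in \<open>F = \<epsilon> (1 - \<kappa> B)\<^bsup>-a\<^esup>\<close> is the one with \<open>a + 2 = a p\<close>: the second
  derivative of \<open>F\<close> in the variable \<open>B\<close> is then of the order of \<open>F\<^sup>p\<close>. The terms with a first
  derivative are of the order \<open>(1 - \<kappa> B)\<^bsup>-a-1\<^esup>\<close>, which is no larger since \<open>1 - \<kappa> B \<le> 1\<close>.\<close>

definition subsolution :: "(real \<Rightarrow> real) \<Rightarrow> real \<Rightarrow> real \<Rightarrow> real \<Rightarrow> real \<Rightarrow> real" where
  "subsolution b p \<kappa> \<epsilon> t = \<epsilon> * (1 - \<kappa> * B_fun b t) powr (- 2 / (p - 1))"

definition subsolution' :: "(real \<Rightarrow> real) \<Rightarrow> real \<Rightarrow> real \<Rightarrow> real \<Rightarrow> real \<Rightarrow> real" where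
  "subsolution' b p \<kappa> \<epsilon> t =
     \<epsilon> * \<kappa> * (2 / (p - 1)) * ((1 - \<kappa> * B_fun b t) powr (- 2 / (p - 1) - 1) / b t)"

definition subsolution'' :: "(real \<Rightarrow> real) \<Rightarrow> real \<Rightarrow> real \<Rightarrow> real \<Rightarrow> real \<Rightarrow> real" where
  "subsolution'' b p \<kappa> \<epsilon> t = \<epsilon> * \<kappa> * (2 / (p - 1)) *
     ((p + 1) / (p - 1) * (\<kappa> / (b t)\<^sup>2) * (1 - \<kappa> * B_fun b t) powr (- 2 / (p - 1) - 2)
      - half_line_deriv 1 b t / (b t)\<^sup>2 * (1 - \<kappa> * B_fun b t) powr (- 2 / (p - 1) - 1))"

lemma subsolution_derivs:
  assumes b: "admissible_damping b \<beta> b1 b2 b3" and p: "p > 1"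
    and t: "t \<in> {0..c}" and pos: "\<kappa> * B_fun b t < 1"
  shows "(subsolution b p \<kappa> \<epsilon> has_real_derivative subsolution' b p \<kappa> \<epsilon> t) (at t within {0..c})"
    and "(subsolution' b p \<kappa> \<epsilon> has_real_derivative subsolution'' b p \<kappa> \<epsilon> t) (at t within {0..c})"
proof -
  let ?g = "\<lambda>t. 1 - \<kappa> * B_fun b t"
  have bt: "b t > 0" using damping_pos[OF b] t by simp
  have g: "(?g has_real_derivative - \<kappa> / b t) (at t within {0..c})"
    by (auto intro!: derivative_eq_intros B_fun_deriv[OF b t])
  have gr: "((\<lambda>t. ?g t powr r) has_real_derivative - \<kappa> / b t * (r * ?g t powr (r - 1)))
      (at t within {0..c})" for r
    using DERIV_chain'[OF g has_real_derivative_powr[of "?g t" r]] pos by (simp add: mult.commute)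
  have b': "(b has_real_derivative half_line_deriv 1 b t) (at t within {0..c})"
    by (rule DERIV_subset[OF damping_deriv[OF b]]) (use t in auto)
  have "subsolution' b p \<kappa> \<epsilon> t =
      \<epsilon> * (- \<kappa> / b t * (- 2 / (p - 1) * ?g t powr (- 2 / (p - 1) - 1)))"
    unfolding subsolution'_def by (simp add: mult_ac)
  then show "(subsolution b p \<kappa> \<epsilon> has_real_derivative subsolution' b p \<kappa> \<epsilon> t) (at t within {0..c})"
    unfolding subsolution_def[abs_def] using DERIV_cmult[OF gr[of "- 2 / (p - 1)"], of \<epsilon>] by simp
  have coeff: "- 2 / (p - 1) - 1 = - ((p + 1) / (p - 1))" using p by (simp add: field_simps)
  have expo: "- 2 / (p - 1) - 1 - 1 = - 2 / (p - 1) - 2" by simp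
  have "q * (\<kappa> / (b t)\<^sup>2) * G2 - h / (b t)\<^sup>2 * G1
      = (- \<kappa> / b t * (- q * G2) * b t - G1 * h) / (b t * b t)" for q h G1 G2
    using bt by (simp add: power2_eq_square diff_divide_distrib mult_ac)
  from this[of "(p + 1) / (p - 1)" "?g t powr (- 2 / (p - 1) - 2)" "half_line_deriv 1 b t"
      "?g t powr (- 2 / (p - 1) - 1)", folded coeff]
  have "subsolution'' b p \<kappa> \<epsilon> t = \<epsilon> * \<kappa> * (2 / (p - 1)) *
      ((- \<kappa> / b t * ((- 2 / (p - 1) - 1) * ?g t powr (- 2 / (p - 1) - 1 - 1)) * b t
        - ?g t powr (- 2 / (p - 1) - 1) * half_line_deriv 1 b t) / (b t * b t))"
    unfolding subsolution''_def expo by (rule arg_cong)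
  then show "(subsolution' b p \<kappa> \<epsilon> has_real_derivative subsolution'' b p \<kappa> \<epsilon> t) (at t within {0..c})"
    unfolding subsolution'_def[abs_def]
    using DERIV_cmult[OF DERIV_divide[OF gr[of "- 2 / (p - 1) - 1"] b'], of "\<epsilon> * \<kappa> * (2 / (p - 1))"] bt
    by simp
qed

lemma subsolution_inequality:
  assumes b: "admissible_damping b \<beta> b1 b2 b3" and beta: "-1 \<le> \<beta>" "\<beta> \<le> 1"
    and B4: "B4 > 0" "\<beta> > -1 \<Longrightarrow> \<forall>\<tau>\<ge>0. B_inv b \<tau> \<le> B4 * (1 + \<tau>) powr (1 / (1 + \<beta>))"
    and p: "p > 1" and A: "A > 0" and \<epsilon>: "0 < \<epsilon>" "\<epsilon> < 1"
    and \<kappa>: "\<kappa> = mu p b \<beta> b1 b3 B4 A * \<epsilon> powr (p - 1)"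
    and t: "0 \<le> t" "\<kappa> * B_fun b t < 1"
  shows "subsolution'' b p \<kappa> \<epsilon> t + b t * subsolution' b p \<kappa> \<epsilon> t \<le> subsolution b p \<kappa> \<epsilon> t powr p"
proof -
  let ?K = "1 / b1\<^sup>2 *
    (if \<beta> = -1 then 1 else (2 powr (1 / (1 + \<beta>)) * (1 + B4)) powr (max 0 (2 * \<beta>)))"
  let ?m = "mu p b \<beta> b1 b3 B4 A"
  let ?g = "1 - \<kappa> * B_fun b t" and ?a = "2 / (p - 1)"
  note m = mu_bounds[OF b p B4(1) A]
  have \<epsilon>1: "\<epsilon> powr (p - 1) \<le> 1" using \<epsilon> p by (intro powr_le1) auto
  have \<kappa>01: "0 < \<kappa>" "\<kappa> \<le> 1"
    unfolding \<kappa> using m(1,2) \<epsilon> \<epsilon>1 by (auto intro: mult_le_one)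
  have B: "0 \<le> B_fun b t" using B_fun_strict_mono[OF b, of 0 t] t(1) by (cases "t = 0") auto
  have g: "0 < ?g" "?g \<le> 1" using t(2) B \<kappa>01 by auto
  have bt: "b t > 0" using damping_pos[OF b t(1)] .
  define G where "G = ?g powr (- ?a - 2)"
  have G: "0 < G" "?g powr (- ?a - 1) \<le> G"
    unfolding G_def using g by (auto intro!: powr_mono')
  have K: "\<kappa> / (b t)\<^sup>2 \<le> ?K"
    using damping_quotient_bound[OF b beta B4 \<kappa>01 t(1)] t(2) by simp
  define d where "d = half_line_deriv 1 b t / (b t)\<^sup>2"
  have d: "\<bar>d\<bar> \<le> b3 / b1" unfolding d_def by (rule inverse_damping_deriv_bound[OF b beta(2) t(1)])
  have "(1 - d) * ?g powr (- ?a - 1) \<le> (1 + b3 / b1) * G"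
    using d G damping_constants_pos[OF b] by (intro mult_mono) auto
  moreover have "(p + 1) / (p - 1) * (\<kappa> / (b t)\<^sup>2) * G \<le> (p + 1) / (p - 1) * ?K * G"
    using K p G by (intro mult_right_mono mult_left_mono) auto
  ultimately have "(p + 1) / (p - 1) * (\<kappa> / (b t)\<^sup>2) * G + (1 - d) * ?g powr (- ?a - 1)
      \<le> (1 + b3 / b1 + (p + 1) / (p - 1) * ?K) * G" by (simp only: distrib_right)
  then have "\<epsilon> * \<kappa> * ?a * ((p + 1) / (p - 1) * (\<kappa> / (b t)\<^sup>2) * G + (1 - d) * ?g powr (- ?a - 1))
      \<le> \<epsilon> * \<kappa> * ?a * ((1 + b3 / b1 + (p + 1) / (p - 1) * ?K) * G)"
    using \<epsilon> \<kappa>01 p by (intro mult_left_mono) auto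
  also have "\<dots> = (?m * (?a * (1 + b3 / b1 + (p + 1) / (p - 1) * ?K))) * (\<epsilon> * \<epsilon> powr (p - 1) * G)"
    unfolding \<kappa> by (simp only: mult_ac)
  also have "\<dots> \<le> 1 * (\<epsilon> * \<epsilon> powr (p - 1) * G)"
    using m(4) \<epsilon> G by (intro mult_right_mono) auto
  also have "\<dots> = subsolution b p \<kappa> \<epsilon> t powr p"
  proof -
    have "\<epsilon> * \<epsilon> powr (p - 1) = \<epsilon> powr p" using \<epsilon> powr_mult_base[of \<epsilon> "p - 1"] by simp
    moreover have "- 2 / (p - 1) * p = - ?a - 2" using p by (simp add: field_simps)
    ultimately show ?thesis
      unfolding subsolution_def G_def using \<epsilon> g by (simp add: powr_mult powr_powr)
  qed
  also have "\<epsilon> * \<kappa> * ?a * ((p + 1) / (p - 1) * (\<kappa> / (b t)\<^sup>2) * G + (1 - d) * ?g powr (- ?a - 1))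
      = subsolution'' b p \<kappa> \<epsilon> t + b t * subsolution' b p \<kappa> \<epsilon> t"
  proof -
    have "b t * subsolution' b p \<kappa> \<epsilon> t = \<epsilon> * \<kappa> * ?a * ?g powr (- ?a - 1)"
      unfolding subsolution'_def using bt by simp
    moreover have "subsolution'' b p \<kappa> \<epsilon> t =
        \<epsilon> * \<kappa> * ?a * ((p + 1) / (p - 1) * (\<kappa> / (b t)\<^sup>2) * G - d * ?g powr (- ?a - 1))"
      unfolding subsolution''_def G_def d_def by simp
    ultimately show ?thesis by (simp only: distrib_left[symmetric]) (simp add: left_diff_distrib)
  qed
  finally show ?thesis .
qed

lemma supersolution_ge_subsolution:
  assumes b: "admissible_damping b \<beta> b1 b2 b3" and beta: "-1 \<le> \<beta>" "\<beta> \<le> 1"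
    and B4: "B4 > 0" "\<beta> > -1 \<Longrightarrow> \<forall>\<tau>\<ge>0. B_inv b \<tau> \<le> B4 * (1 + \<tau>) powr (1 / (1 + \<beta>))"
    and p: "p > 1" and A: "A > 0" and \<epsilon>: "0 < \<epsilon>" "\<epsilon> < 1"
    and \<kappa>: "\<kappa> = mu p b \<beta> b1 b3 B4 A * \<epsilon> powr (p - 1)"
    and y: "\<And>t. t \<in> {0..c} \<Longrightarrow> (y has_real_derivative y1 t) (at t within {0..c})"
    and y1: "\<And>t. t \<in> {0..c} \<Longrightarrow> (y1 has_real_derivative y2 t) (at t within {0..c})"
    and init: "y 0 = \<epsilon>" "y1 0 = A * \<epsilon>"
    and ineq: "\<And>t. t \<in> {0..c} \<Longrightarrow> y t \<ge> 0 \<Longrightarrow> y t powr p \<le> y2 t + b t * y1 t"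
    and c: "0 \<le> c" "\<kappa> * B_fun b c < 1"
  shows "subsolution b p \<kappa> \<epsilon> c \<le> y c"
proof (cases "c = 0")
  case True
  then show ?thesis using init by (simp add: subsolution_def)
next
  case False
  then have c0: "c > 0" using c by simp
  let ?F = "subsolution b p \<kappa> \<epsilon>" and ?F1 = "subsolution' b p \<kappa> \<epsilon>" and ?F2 = "subsolution'' b p \<kappa> \<epsilon>"
  let ?m = "mu p b \<beta> b1 b3 B4 A"
  note m = mu_bounds[OF b p B4(1) A]
  have \<kappa>0: "0 < \<kappa>" unfolding \<kappa> using m(1) \<epsilon> by simp
  have g: "\<kappa> * B_fun b t < 1" if "t \<in> {0..c}" for t
  proof -
    have "B_fun b t \<le> B_fun b c"
      using B_fun_strict_mono[OF b, of t c] that by (cases "t = c") auto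
    then have "\<kappa> * B_fun b t \<le> \<kappa> * B_fun b c" using \<kappa>0 by simp
    then show ?thesis using c(2) by simp
  qed
  obtain M where M: "\<And>t. t \<in> {0..c} \<Longrightarrow> b t \<le> M"
  proof -
    have "compact (b ` {0..c})"
      by (intro compact_continuous_image damping_continuous_on[OF b] compact_Icc)
    then obtain M where "\<And>x. x \<in> b ` {0..c} \<Longrightarrow> norm x \<le> M"
      using compact_imp_bounded bounded_iff by metis
    then show ?thesis using that[of M] by fastforce
  qed
  have D: "((\<lambda>t. y t - ?F t) has_real_derivative y1 t - ?F1 t) (at t within {0..c})"
    and D1: "((\<lambda>t. y1 t - ?F1 t) has_real_derivative y2 t - ?F2 t) (at t within {0..c})"
    if t: "t \<in> {0..c}" for t
    using DERIV_diff[OF y[OF t] subsolution_derivs(1)[OF b p t g[OF t]]]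
      DERIV_diff[OF y1[OF t] subsolution_derivs(2)[OF b p t g[OF t]]] by blast+
  have D_init: "y 0 - ?F 0 = 0" using init by (simp add: subsolution_def)
  have D1_init: "0 < y1 0 - ?F1 0"
  proof -
    have b0: "b 0 > 0" using damping_pos[OF b, of 0] by simp
    have "?F1 0 = \<epsilon> * \<epsilon> powr (p - 1) * (2 / (p - 1) / b 0 * ?m)"
      unfolding subsolution'_def \<kappa> by simp
    also have "\<dots> \<le> \<epsilon> * \<epsilon> powr (p - 1) * (2 / (p - 1) / b 0 * ((p - 1) / 2 * b 0 * A))"
      using m(3) \<epsilon> p b0 by (intro mult_left_mono) auto
    also have "\<dots> = \<epsilon> * A * \<epsilon> powr (p - 1)" using p b0 by simp
    also have "\<dots> < \<epsilon> * A * 1"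
    proof (rule mult_strict_left_mono)
      show "\<epsilon> powr (p - 1) < 1" using \<epsilon> p powr_less_mono2[of "p - 1" \<epsilon> 1] by simp
    qed (use \<epsilon> A in simp)
    finally show ?thesis using init by (simp add: mult.commute)
  qed
  have D_ineq: "0 \<le> y2 t - ?F2 t + b t * (y1 t - ?F1 t)"
    if t: "t \<in> {0..c}" and pos: "0 < y t - ?F t" for t
  proof -
    have F: "0 \<le> ?F t" unfolding subsolution_def using \<epsilon> by simp
    have "?F2 t + b t * ?F1 t \<le> ?F t powr p"
      using subsolution_inequality[OF b beta B4 p A \<epsilon> \<kappa> _ g[OF t]] t by simp
    also have "\<dots> \<le> y t powr p" using pos F p by (intro powr_mono2) auto
    also have "\<dots> \<le> y2 t + b t * y1 t" using ineq[OF t] pos F by simp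
    finally show ?thesis by (simp add: algebra_simps)
  qed
  have "0 < y c - ?F c"
    by (rule positive_velocity_persists[OF D D1 M D_init D1_init D_ineq c0])
  then show ?thesis by simp
qed

text \<open>A solution that lived up to the explosion time of the subsolution would stay bounded there,
  and the subsolution below it does not.\<close>

lemma blow_up_time_not_reached:
  assumes b: "admissible_damping b \<beta> b1 b2 b3" and beta: "-1 \<le> \<beta>"
    and p: "p > 1" and \<epsilon>: "0 < \<epsilon>" and \<kappa>: "0 < \<kappa>"
    and y: "continuous_on {0..s} y"
    and ge: "\<And>t. t \<in> {0..s} \<Longrightarrow> \<kappa> * B_fun b t < 1 \<Longrightarrow> subsolution b p \<kappa> \<epsilon> t \<le> y t"
    and s: "0 \<le> s"
  shows "\<kappa> * B_fun b s < 1"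
proof (rule ccontr)
  assume *: "\<not> \<kappa> * B_fun b s < 1"
  have "bounded (y ` {0..s})"
    by (intro compact_imp_bounded compact_continuous_image y compact_Icc)
  then obtain Y0 where "\<And>x. x \<in> y ` {0..s} \<Longrightarrow> norm x \<le> Y0"
    unfolding bounded_iff by blast
  then have "\<bar>y t\<bar> \<le> Y0" if "t \<in> {0..s}" for t
    using that by fastforce
  then obtain Y where Y: "Y > 0" "\<And>t. t \<in> {0..s} \<Longrightarrow> y t \<le> Y"
    by (meson abs_le_D1 le_less_linear max.coboundedI1 max.cobounded2 max.strict_coboundedI2 order_trans zero_less_one)
  (* at the time t chosen here the subsolution takes the value Y + \<epsilon> *)
  define \<delta> where "\<delta> = (\<epsilon> / (Y + \<epsilon>)) powr ((p - 1) / 2)"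
  have q: "0 < \<epsilon> / (Y + \<epsilon>)" "\<epsilon> / (Y + \<epsilon>) < 1" using Y(1) \<epsilon> by auto
  have \<delta>: "0 < \<delta>" "\<delta> < 1"
    unfolding \<delta>_def using q p Y(1) \<epsilon> powr_less_mono2[of "(p - 1) / 2" "\<epsilon> / (Y + \<epsilon>)" 1] by simp_all
  define t where "t = B_inv b ((1 - \<delta>) / \<kappa>)"
  have "0 \<le> (1 - \<delta>) / \<kappa>" using \<delta> \<kappa> by simp
  then have t: "0 \<le> t" "B_fun b t = (1 - \<delta>) / \<kappa>"
    unfolding t_def using B_inv_nonneg[OF b beta] B_fun_B_inv[OF b beta] by auto
  have "t \<le> s"
  proof (rule ccontr)
    assume "\<not> t \<le> s"
    then have "\<kappa> * B_fun b s < \<kappa> * B_fun b t"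
      using B_fun_strict_mono[OF b s] \<kappa> by simp
    then show False using * t(2) \<kappa> \<delta> by simp
  qed
  moreover have kt: "\<kappa> * B_fun b t = 1 - \<delta>" using t(2) \<kappa> by simp
  ultimately have "subsolution b p \<kappa> \<epsilon> t \<le> Y"
    using ge[of t] Y(2)[of t] t(1) \<delta>(1) by auto
  moreover have "\<delta> powr (- 2 / (p - 1)) = (Y + \<epsilon>) / \<epsilon>"
  proof -
    have "\<delta> powr (- 2 / (p - 1)) = (\<epsilon> / (Y + \<epsilon>)) powr ((p - 1) / 2 * (- 2 / (p - 1)))"
      unfolding \<delta>_def by (rule powr_powr)
    also have "(p - 1) / 2 * (- 2 / (p - 1)) = -1" using p by simp
    also have "(\<epsilon> / (Y + \<epsilon>)) powr (-1) = (Y + \<epsilon>) / \<epsilon>" using Y(1) \<epsilon> by (simp add: powr_minus)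
    finally show ?thesis .
  qed
  ultimately show False
    unfolding subsolution_def kt using \<epsilon> by simp
qed

section \<open>The lower bound and the lifespan\<close>

theorem proposition1p3:
  fixes b :: "real \<Rightarrow> real" and \<beta> b1 b2 b3 B4 p :: real and l :: nat
    and u0 :: "'n::finite H1" and u1 :: "'n L2" and u :: "real \<Rightarrow> 'n H1"
    and T0 :: ereal and \<phi> :: "real^'n \<Rightarrow> real"
    and I J :: "real \<Rightarrow> real" and Jtilde0 A1 m :: real
  assumes beta: "-1 \<le> \<beta>" "\<beta> \<le> 1"
    and damping: "admissible_damping b \<beta> b1 b2 b3"
    and B4: "B4 > 0"
      "\<beta> > -1 \<Longrightarrow> \<forall>\<tau>\<ge>0. B_inv b \<tau> \<le> B4 * (1 + \<tau>) powr (1 / (1 + \<beta>))"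
    and p: "p > 1"
    and l: "real l > 2 * conj_exp p"
    and T0: "T0 = lifespan b p u0 u1 u"
    and solution: "strong_solution b p u0 u1 T0 u"
    and phi: "schwartz \<phi>" "\<forall>x. \<phi> x \<ge> 0"
    and I: "I = I_fun l \<phi> u"
    and J: "J = (\<lambda>t. I t - A_const p l \<phi>)"
    and small: "0 < I 0 - A_const p l \<phi>"
      "I 0 - A_const p l \<phi> < 2 powr (1 / (p - 1)) * L1_norm (\<lambda>x. \<phi> x ^ l)"
    and slope: "deriv_on (time_interval T0) I 0 > 0"
    and Jtilde0: "Jtilde0 = 2 powr (- 1 / (p - 1)) * inverse (L1_norm (\<lambda>x. \<phi> x ^ l)) * J 0"
    and A1: "A1 = deriv_on (time_interval T0) J 0 / J 0"
    and m: "m = mu p b \<beta> b1 b3 B4 A1"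
  shows "(\<forall>t\<in>time_interval T0.
            J t \<ge> J 0 * (1 - m * Jtilde0 powr (p - 1) * B_fun b t) powr (- 2 / (p - 1)))
         \<and> T0 \<le> ereal (B_inv b (inverse m * Jtilde0 powr (1 - p)))"
proof -
  let ?S = "time_interval T0" and ?L = "L1_norm (\<lambda>x. \<phi> x ^ l)" and ?A = "A_const p l \<phi>"
  let ?\<psi> = "\<lambda>x. \<phi> x ^ l"
  have \<phi>0: "\<phi> x \<ge> 0" for x using phi(2) by blast
  have "conj_exp p > 1" using p by (simp add: conj_exp_def field_simps)
  then have "l > 0" using l by simp
  then have \<psi>: "schwartz ?\<psi>" by (intro schwartz_power phi(1))
  have "0 < 2 powr (1 / (p - 1)) * ?L" using small by linarith
  then have L: "?L > 0" by (simp add: zero_less_mult_iff)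

  have I_eq: "I = (\<lambda>t. LINT x|lborel. rep_L2 (H1_L2 (u t)) x * ?\<psi> x)"
    unfolding I by (rule ext) (rule I_fun_def)
  obtain I1 I2 where I1: "\<And>t. t \<in> ?S \<Longrightarrow> (I has_real_derivative I1 t) (at t within ?S)"
    and I2: "\<And>t. t \<in> ?S \<Longrightarrow> (I1 has_real_derivative I2 t) (at t within ?S)"
    and int: "\<And>t. t \<in> ?S \<Longrightarrow> integrable lborel (\<lambda>x. \<bar>rep_L2 (H1_L2 (u t)) x\<bar> powr p * ?\<psi> x)"
    and eq: "\<And>t. t \<in> ?S \<Longrightarrow> I2 t + b t * I1 t =
       (LINT x|lborel. \<bar>rep_L2 (H1_L2 (u t)) x\<bar> powr p * ?\<psi> x)
       + (LINT x|lborel. rep_L2 (H1_L2 (u t)) x * laplacian ?\<psi> x)"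
    by (rule strong_solution_tested[OF solution \<psi>, folded I_eq]) (rule that; blast)

  have "0 < T0" using solution by (simp add: strong_solution_def Let_def)
  then have S0: "0 \<in> ?S" by (simp add: time_interval_def zero_ereal_def[symmetric])
  have S_sub: "{0..s} \<subseteq> ?S" if "s \<in> ?S" for s
    using that by (auto simp: time_interval_def intro: le_less_trans[of _ "ereal s"])
  have J1: "(J has_real_derivative I1 t) (at t within ?S)" if "t \<in> ?S" for t
    unfolding J using DERIV_diff[OF I1[OF that] DERIV_const[of ?A]] by simp
  have deriv0: "deriv_on ?S I 0 = I1 0" "deriv_on ?S J 0 = I1 0"
    by (rule deriv_on_eqI[OF _ S0],
        rule I1[OF S0, unfolded has_real_derivative_iff_has_vector_derivative])
      (rule deriv_on_eqI[OF _ S0],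
        rule J1[OF S0, unfolded has_real_derivative_iff_has_vector_derivative])
  have J0: "J 0 > 0" using small(1) unfolding J .
  have A1_pos: "A1 > 0" using slope J0 unfolding A1 deriv0 by simp

  (* dividing J by this factor turns the nonlinearity of the inequality into y powr p *)
  define c where "c = 2 powr (1 / (p - 1)) * ?L"
  have c: "c > 0" unfolding c_def using L by simp
  have c_powr: "c powr p = c * (2 * ?L powr (p - 1))"
  proof -
    have "c powr p = c * c powr (p - 1)" using c powr_mult_base[of c "p - 1"] by simp
    also have "c powr (p - 1) = 2 * ?L powr (p - 1)"
      unfolding c_def using L p by (simp add: powr_mult powr_powr)
    finally show ?thesis .
  qed
  define y where "y t = J t / c" for t
  have y0: "y 0 = Jtilde0"
    unfolding y_def Jtilde0 c_def by (simp add: powr_minus divide_inverse mult_ac)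
  have \<epsilon>: "0 < Jtilde0" "Jtilde0 < 1"
    unfolding y0[symmetric] y_def using J0 c small(2) unfolding c_def J by simp_all

  have ineq: "y t powr p \<le> I2 t / c + b t * (I1 t / c)" if t: "t \<in> ?S" and "y t \<ge> 0" for t
  proof -
    have Jt: "J t \<ge> 0" using that(2) c unfolding y_def by (simp add: zero_le_divide_iff)
    then have "?A \<le> (LINT x|lborel. rep_L2 (H1_L2 (u t)) x * ?\<psi> x)"
      unfolding J I_eq by simp
    from tested_nonlinearity_lower_bound[OF p l phi(1) \<phi>0 L square_integrable_rep_L2 int[OF t] this]
    have le: "1 / 2 * ?L powr (1 - p) * J t powr p \<le> I2 t + b t * I1 t"
      unfolding eq[OF t] unfolding J I_eq .
    have y_powr: "y t powr p = 1 / 2 * ?L powr (1 - p) * J t powr p / c"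
    proof -
      have L_powr: "?L powr (1 - p) = inverse (?L powr (p - 1))"
        using powr_minus[of ?L "p - 1"] by simp
      have "j / (c * (2 * k)) = 1 / 2 * inverse k * j / c" for j k :: real
        by (simp add: field_simps)
      then show ?thesis
        unfolding y_def powr_divide c_powr L_powr .
    qed
    have "y t powr p \<le> (I2 t + b t * I1 t) / c"
      unfolding y_powr using c by (intro divide_right_mono le) simp
    then show ?thesis by (simp add: add_divide_distrib)
  qed

  define \<kappa> where "\<kappa> = m * Jtilde0 powr (p - 1)"
  have m_pos: "m > 0" unfolding m by (rule mu_bounds(1)[OF damping p B4(1) A1_pos])
  have \<kappa>_pos: "\<kappa> > 0" unfolding \<kappa>_def using m_pos \<epsilon> by simp

  have y1: "(y has_real_derivative I1 t / c) (at t within {0..s})"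
    and y2: "((\<lambda>t. I1 t / c) has_real_derivative I2 t / c) (at t within {0..s})"
    if "s \<in> ?S" "t \<in> {0..s}" for s t
  proof -
    have "t \<in> ?S" using S_sub that by blast
    then show "(y has_real_derivative I1 t / c) (at t within {0..s})"
      and "((\<lambda>t. I1 t / c) has_real_derivative I2 t / c) (at t within {0..s})"
      unfolding y_def
      using DERIV_cdivide[OF J1, of t c] DERIV_cdivide[OF I2, of t c] S_sub[OF that(1)]
      by (blast intro: DERIV_subset)+
  qed
  have lower: "subsolution b p \<kappa> Jtilde0 t \<le> y t" if "t \<in> ?S" "\<kappa> * B_fun b t < 1" for t
  proof (rule supersolution_ge_subsolution[OF damping beta B4 p A1_pos \<epsilon> _ y1[OF that(1)]
        y2[OF that(1)] y0 _ _ _ that(2)])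
    show "\<kappa> = mu p b \<beta> b1 b3 B4 A1 * Jtilde0 powr (p - 1)" unfolding \<kappa>_def m ..
    show "I1 0 / c = A1 * Jtilde0"
      unfolding A1 deriv0 y0[symmetric] y_def using J0 by simp
    show "y s powr p \<le> I2 s / c + b s * (I1 s / c)" if "s \<in> {0..t}" "0 \<le> y s" for s
      using ineq S_sub \<open>t \<in> ?S\<close> that by blast
    show "0 \<le> t" using \<open>t \<in> ?S\<close> by (simp add: time_interval_def)
  qed
  have before: "\<kappa> * B_fun b s < 1" if "s \<in> ?S" for s
  proof (rule blow_up_time_not_reached[OF damping beta(1) p \<epsilon>(1) \<kappa>_pos])
    show "continuous_on {0..s} y" by (rule DERIV_continuous_on[OF y1[OF that]])
    show "subsolution b p \<kappa> Jtilde0 t \<le> y t" if "t \<in> {0..s}" "\<kappa> * B_fun b t < 1" for t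
      using lower S_sub \<open>s \<in> ?S\<close> that by blast
    show "0 \<le> s" using that by (simp add: time_interval_def)
  qed

  have "J 0 * (1 - m * Jtilde0 powr (p - 1) * B_fun b t) powr (- 2 / (p - 1)) \<le> J t"
    if "t \<in> ?S" for t
  proof -
    have "c * subsolution b p \<kappa> Jtilde0 t \<le> c * y t"
      using lower[OF that before[OF that]] c by simp
    then show ?thesis
      unfolding subsolution_def \<kappa>_def y0[symmetric] unfolding y_def using c by simp
  qed
  moreover have "T0 \<le> ereal (B_inv b (inverse m * Jtilde0 powr (1 - p)))"
  proof (rule ccontr)
    let ?\<tau> = "inverse m * Jtilde0 powr (1 - p)"
    assume "\<not> T0 \<le> ereal (B_inv b ?\<tau>)"
    moreover have \<tau>: "0 \<le> ?\<tau>" using m_pos by simp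
    ultimately have "B_inv b ?\<tau> \<in> ?S"
      using B_inv_nonneg[OF damping beta(1) \<tau>] by (simp add: time_interval_def)
    from before[OF this] have "\<kappa> * ?\<tau> < 1"
      unfolding B_fun_B_inv[OF damping beta(1) \<tau>] .
    moreover have "\<kappa> * ?\<tau> = 1"
    proof -
      have "Jtilde0 powr (p - 1) * Jtilde0 powr (1 - p) = 1"
        using \<epsilon> by (simp add: powr_add[symmetric])
      then show ?thesis unfolding \<kappa>_def using m_pos by (simp add: field_simps)
    qed
    ultimately show False by simp
  qed
  ultimately show ?thesis by blast
qed

end
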